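(* Let $T\in L(l^{\infty})$ be an adjoint operator, i.e. there exists some $S\in L(l^1)$ with $T=S^{*}$. Then the following statements are equivalent: (i) $T$ is $J^{mix}$-class. (ii) $T$ is $J$-class. (iii) $J_{T}(x)$ has non-empty interior for some non-zero vector $x\in l^\infty$. (iv) $\sigma(T)\cap\partial\mathbb{D}\neq\emptyset$ and $\sigma_{p}(T^{*})\cap\overline{\mathbb{D}}=\emptyset$. (v) $i(S)>1$ and $\overline{\mathbb{D}}\subseteq\sigma_{p}(T)$. (vi) $i(S)>1$ and $0\in\sigma_{p}(T)$.
   Context: All Banach spaces are complex; $l^\infty=(l^1)^*$ carries the sup-norm. $L(X)$ is the space of bounded linear operators on $X$, $\sigma(T)$ the spectrum, $\sigma_p(T)$ the set of eigenvalues, $T^*$ the Banach space adjoint (so $T^*$ acts on $(l^\infty)^*$), $\mathbb{D}$ the open unit disc. For $R\in L(X)$, $\kappa(R):=\inf\{\|Rx\|: x\in X,\ \|x\|=1\}$ and $i(R):=\lim_{n\to\infty}\kappa(R^n)^{1/n}$. For $T\in L(X)$ and $x\in X$, $J_T(x)$ is the set of all $y\in X$ for which there exist a strictly increasing sequence $(k_n)$ of natural numbers and a sequence $(x_n)$ in $X$ with $x_n\to x$ and $T^{k_n}x_n\to y$; $T$ is $J$-class if $J_T(x)=X$ for some $x\neq0$. $J_T^{mix}(x)$ is the set of all $y\in X$ for which there exists a sequence $(x_n)$ in $X$ with $x_n\to x$ and $T^{n}x_n\to y$; $T$ is $J^{mix}$-class if $J_T^{mix}(x)=X$ for some $x\neq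 0$. *)

theory Defs
  imports "HOL-Analysis.Analysis"
begin

section \<open>Complex Banach spaces\<close>

text \<open>
  The library class \<^class>\<open>banach\<close> is over the reals; a complex Banach space adds a complex scalar
  multiplication that extends the real one and is compatible with the norm.
\<close>

class cbanach = banach +
  fixes scaleC :: "complex \<Rightarrow> 'a \<Rightarrow> 'a" (infixr \<open>*\<^sub>C\<close> 75)
  assumes scaleC_add_right: "a *\<^sub>C (x + y) = a *\<^sub>C x + a *\<^sub>C y"
    and scaleC_add_left: "(a + b) *\<^sub>C x = a *\<^sub>C x + b *\<^sub>C x"
    and scaleC_scaleC [simp]: "a *\<^sub>C (b *\<^sub>C x) = (a * b) *\<^sub>C x"
    and scaleC_of_real [simp]: "complex_of_real r *\<^sub>C x = r *\<^sub>R x"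
    and norm_scaleC [simp]: "norm (a *\<^sub>C x) = cmod a * norm x"

lemma scaleC_one [simp]: "1 *\<^sub>C (x :: 'a::cbanach) = x"
  using scaleC_of_real[of 1 x] by simp

lemma scaleC_zero_left [simp]: "0 *\<^sub>C (x :: 'a::cbanach) = 0"
  using scaleC_of_real[of 0 x] by simp

lemma scaleC_zero_right [simp]: "a *\<^sub>C (0 :: 'a::cbanach) = 0"
  using scaleC_add_right[of a 0 0] by simp

lemma scaleC_scaleR_commute: "a *\<^sub>C (r *\<^sub>R x) = r *\<^sub>R (a *\<^sub>C (x :: 'a::cbanach))"
  using scaleC_scaleC[of a "of_real r" x] scaleC_scaleC[of "of_real r" a x]
  by (simp add: mult.commute del: scaleC_scaleC)

lemma scaleC_minus_right: "a *\<^sub>C (- x) = - (a *\<^sub>C (x :: 'a::cbanach))"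
  using scaleC_scaleR_commute[of a "-1" x] by simp

lemma scaleC_diff_right: "a *\<^sub>C (x - y) = a *\<^sub>C x - a *\<^sub>C (y :: 'a::cbanach)"
  using scaleC_add_right[of a x "- y"] by (simp add: scaleC_minus_right)

lemma bounded_linear_scaleC: "bounded_linear (\<lambda>x :: 'a::cbanach. a *\<^sub>C x)"
  by (rule bounded_linear_intro[where K = "cmod a"])
    (auto simp: scaleC_add_right scaleC_scaleR_commute mult.commute)

instantiation complex :: cbanach
begin

definition scaleC_complex :: "complex \<Rightarrow> complex \<Rightarrow> complex"
  where [simp]: "scaleC_complex = (*)"

instance
  by standard (auto simp: algebra_simps norm_mult scaleR_conv_of_real)

end


section \<open>Bounded complex-linear operators, dual spaces and adjoints\<close>

typedef (overloaded) ('a, 'b) clop (\<open>(_ \<Rightarrow>\<^sub>B /_)\<close> [22, 21] 21) =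
  "{f :: 'a::cbanach \<Rightarrow>\<^sub>L 'b::cbanach. \<forall>c x. blinfun_apply f (c *\<^sub>C x) = c *\<^sub>C blinfun_apply f x}"
  morphisms blinfun_of_clop Abs_clop
  by (rule exI[of _ 0]) simp

setup_lifting type_definition_clop

lift_definition clop_apply :: "('a::cbanach \<Rightarrow>\<^sub>B 'b::cbanach) \<Rightarrow> 'a \<Rightarrow> 'b" is blinfun_apply .

lemma clop_eqI: "(\<And>x. clop_apply f x = clop_apply g x) \<Longrightarrow> f = g"
  by transfer (rule blinfun_eqI)

lemma bounded_linear_clop_apply: "bounded_linear (clop_apply f)"
  by transfer (rule blinfun.bounded_linear_right)

lemma clop_scaleC: "clop_apply f (c *\<^sub>C x) = c *\<^sub>C clop_apply f x"
  by transfer simp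

lemma clop_exists:
  fixes f :: "'a::cbanach \<Rightarrow> 'b::cbanach"
  assumes "bounded_linear f" "\<And>c x. f (c *\<^sub>C x) = c *\<^sub>C f x"
  shows "\<exists>F. clop_apply F = f"
proof -
  have *: "Blinfun f \<in> {f. \<forall>c x. blinfun_apply f (c *\<^sub>C x) = c *\<^sub>C blinfun_apply f x}"
    using assms by (simp add: bounded_linear_Blinfun_apply)
  show ?thesis
    by (rule exI[of _ "Abs_clop (Blinfun f)"])
      (simp add: clop_apply.rep_eq Abs_clop_inverse[OF *] bounded_linear_Blinfun_apply assms)
qed

instantiation clop :: (cbanach, cbanach) real_normed_vector
begin

lift_definition zero_clop :: "'a \<Rightarrow>\<^sub>B 'b" is 0 by simp
lift_definition plus_clop :: "('a \<Rightarrow>\<^sub>B 'b) \<Rightarrow> ('a \<Rightarrow>\<^sub>B 'b) \<Rightarrow> 'a \<Rightarrow>\<^sub>B 'b" is "(+)"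
  by (simp add: blinfun.add_left scaleC_add_right)
lift_definition uminus_clop :: "('a \<Rightarrow>\<^sub>B 'b) \<Rightarrow> 'a \<Rightarrow>\<^sub>B 'b" is uminus
  by (simp add: blinfun.minus_left scaleC_minus_right)
lift_definition minus_clop :: "('a \<Rightarrow>\<^sub>B 'b) \<Rightarrow> ('a \<Rightarrow>\<^sub>B 'b) \<Rightarrow> 'a \<Rightarrow>\<^sub>B 'b" is "(-)"
  by (simp add: blinfun.diff_left scaleC_diff_right)
lift_definition scaleR_clop :: "real \<Rightarrow> ('a \<Rightarrow>\<^sub>B 'b) \<Rightarrow> 'a \<Rightarrow>\<^sub>B 'b" is "(*\<^sub>R)"
  by (simp add: blinfun.scaleR_left scaleC_scaleR_commute)
lift_definition norm_clop :: "('a \<Rightarrow>\<^sub>B 'b) \<Rightarrow> real" is norm .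
lift_definition dist_clop :: "('a \<Rightarrow>\<^sub>B 'b) \<Rightarrow> ('a \<Rightarrow>\<^sub>B 'b) \<Rightarrow> real" is dist .
lift_definition sgn_clop :: "('a \<Rightarrow>\<^sub>B 'b) \<Rightarrow> 'a \<Rightarrow>\<^sub>B 'b" is sgn
  by (simp add: sgn_div_norm blinfun.scaleR_left scaleC_scaleR_commute)
definition uniformity_clop :: "(('a \<Rightarrow>\<^sub>B 'b) \<times> ('a \<Rightarrow>\<^sub>B 'b)) filter"
  where "uniformity_clop = (INF e\<in>{0 <..}. principal {(x, y). dist x y < e})"
definition open_clop :: "('a \<Rightarrow>\<^sub>B 'b) set \<Rightarrow> bool"
  where "open_clop S = (\<forall>x\<in>S. \<forall>\<^sub>F (x', y) in uniformity. x' = x \<longrightarrow> y \<in> S)"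

instance
  apply standard
  subgoal by transfer (simp add: dist_norm)
  subgoal by transfer (simp add: algebra_simps)
  subgoal by transfer (simp add: algebra_simps)
  subgoal by transfer (simp add: algebra_simps)
  subgoal by transfer (simp add: algebra_simps)
  subgoal by transfer (simp add: algebra_simps)
  subgoal by transfer (simp add: algebra_simps)
  subgoal by transfer (simp add: algebra_simps)
  subgoal by transfer (simp add: algebra_simps)
  subgoal by transfer (simp add: algebra_simps)
  subgoal by transfer (simp add: sgn_div_norm)
  subgoal by (simp add: uniformity_clop_def)
  subgoal by (simp add: open_clop_def)
  subgoal by transfer simp
  subgoal by transfer (simp add: norm_triangle_ineq)
  subgoal by transfer simp
  done

end

lemma norm_clop_le: "norm (clop_apply f x) \<le> norm f * norm x"
  by transfer (rule norm_blinfun)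

lemma norm_clop_bound: "0 \<le> b \<Longrightarrow> (\<And>x. norm (clop_apply f x) \<le> b * norm x) \<Longrightarrow> norm f \<le> b"
  by transfer (rule norm_blinfun_bound)

lemma clop_apply_zero [simp]: "clop_apply 0 x = 0"
  by transfer simp
lemma clop_apply_add: "clop_apply (f + g) x = clop_apply f x + clop_apply g x"
  by transfer (simp add: blinfun.add_left)
lemma clop_apply_diff: "clop_apply (f - g) x = clop_apply f x - clop_apply g x"
  by transfer (simp add: blinfun.diff_left)
lemma clop_apply_scaleR: "clop_apply (r *\<^sub>R f) x = r *\<^sub>R clop_apply f x"
  by transfer (simp add: blinfun.scaleR_left)

instance clop :: (cbanach, cbanach) banach
proof
  fix X :: "nat \<Rightarrow> 'a \<Rightarrow>\<^sub>B 'b"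
  assume X: "Cauchy X"
  have d: "dist (blinfun_of_clop f) (blinfun_of_clop g) = dist f g" for f g :: "'a \<Rightarrow>\<^sub>B 'b"
    by transfer simp
  have "Cauchy (\<lambda>n. blinfun_of_clop (X n))"
    using X by (simp add: Cauchy_def d)
  then obtain L where L: "(\<lambda>n. blinfun_of_clop (X n)) \<longlonglongrightarrow> L"
    by (auto simp: Cauchy_convergent_iff convergent_def)
  have lim: "(\<lambda>n. blinfun_of_clop (X n) x) \<longlonglongrightarrow> L x" for x
    by (intro blinfun.tendsto L tendsto_const)
  have "L (c *\<^sub>C x) = c *\<^sub>C L x" for c x
  proof (rule LIMSEQ_unique)
    show "(\<lambda>n. blinfun_of_clop (X n) (c *\<^sub>C x)) \<longlonglongrightarrow> L (c *\<^sub>C x)"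
      by (rule lim)
    have "(\<lambda>n. c *\<^sub>C blinfun_of_clop (X n) x) \<longlonglongrightarrow> c *\<^sub>C L x"
      by (rule bounded_linear.tendsto[OF bounded_linear_scaleC lim])
    then show "(\<lambda>n. blinfun_of_clop (X n) (c *\<^sub>C x)) \<longlonglongrightarrow> c *\<^sub>C L x"
      by (simp only: clop_apply.rep_eq[symmetric] clop_scaleC)
  qed
  then have K: "L = blinfun_of_clop (Abs_clop L)"
    by (intro Abs_clop_inverse[symmetric]) blast
  have "X \<longlonglongrightarrow> Abs_clop L"
    using L by (subst (asm) K) (simp only: tendsto_iff d)
  then show "convergent X"
    by (rule convergentI)
qed

instantiation clop :: (cbanach, cbanach) cbanach
begin

lift_definition scaleC_clop :: "complex \<Rightarrow> ('a \<Rightarrow>\<^sub>B 'b) \<Rightarrow> 'a \<Rightarrow>\<^sub>B 'b"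
  is "\<lambda>c f. blinfun_compose (Blinfun ((*\<^sub>C) c)) f"
  by (simp add: bounded_linear_Blinfun_apply bounded_linear_scaleC mult.commute)

lemma clop_apply_scaleC: "clop_apply (c *\<^sub>C f) x = c *\<^sub>C clop_apply f x"
  by transfer (simp add: bounded_linear_Blinfun_apply bounded_linear_scaleC)

instance
proof
  fix a b :: complex and r :: real and f g :: "'a \<Rightarrow>\<^sub>B 'b"
  show "a *\<^sub>C (f + g) = a *\<^sub>C f + a *\<^sub>C g" "(a + b) *\<^sub>C f = a *\<^sub>C f + b *\<^sub>C f"
    "a *\<^sub>C b *\<^sub>C f = (a * b) *\<^sub>C f" "complex_of_real r *\<^sub>C f = r *\<^sub>R f"
    by (auto intro!: clop_eqI
        simp: clop_apply_scaleC clop_apply_add clop_apply_scaleR scaleC_add_left scaleC_add_right)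
  have le: "norm (a *\<^sub>C f) \<le> cmod a * norm f" for a and f :: "'a \<Rightarrow>\<^sub>B 'b"
    by (rule norm_clop_bound)
      (auto simp: clop_apply_scaleC mult.assoc intro!: mult_left_mono norm_clop_le)
  show "norm (a *\<^sub>C f) = cmod a * norm f"
  proof (cases "a = 0")
    case True
    then show ?thesis using le[of a f] by simp
  next
    case False
    have "inverse a *\<^sub>C a *\<^sub>C f = f"
      using False by (auto intro!: clop_eqI simp: clop_apply_scaleC)
    then have "norm f \<le> cmod (inverse a) * norm (a *\<^sub>C f)"
      using le[of "inverse a" "a *\<^sub>C f"] by simp
    then have "cmod a * norm f \<le> cmod a * (cmod (inverse a) * norm (a *\<^sub>C f))"
      by (rule mult_left_mono) simp
    also have "\<dots> = norm (a *\<^sub>C f)"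
      unfolding mult.assoc[symmetric] norm_mult[symmetric] using False by simp
    finally have "cmod a * norm f \<le> norm (a *\<^sub>C f)" .
    then show ?thesis using le[of a f] by simp
  qed
qed

end

type_synonym 'a dual = "'a \<Rightarrow>\<^sub>B complex"

lift_definition clop_id :: "'a::cbanach \<Rightarrow>\<^sub>B 'a" is id_blinfun by simp

lift_definition clop_compose ::
  "('b::cbanach \<Rightarrow>\<^sub>B 'c::cbanach) \<Rightarrow> ('a::cbanach \<Rightarrow>\<^sub>B 'b) \<Rightarrow> 'a \<Rightarrow>\<^sub>B 'c" (infixl \<open>o\<^sub>B\<close> 67)
  is blinfun_compose by simp

lemma clop_id_apply [simp]: "clop_apply clop_id x = x"
  by transfer simp

lemma clop_compose_apply [simp]: "clop_apply (f o\<^sub>B g) x = clop_apply f (clop_apply g x)"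
  by transfer simp

lemma norm_clop_compose: "norm (f o\<^sub>B g) \<le> norm f * norm g"
  by transfer (rule norm_blinfun_compose)

primrec clop_power :: "('a::cbanach \<Rightarrow>\<^sub>B 'a) \<Rightarrow> nat \<Rightarrow> 'a \<Rightarrow>\<^sub>B 'a" (infixr \<open>^\<^sub>B\<close> 80) where
  "T ^\<^sub>B 0 = clop_id"
| "T ^\<^sub>B Suc n = T o\<^sub>B (T ^\<^sub>B n)"

definition banach_adjoint :: "('a::cbanach \<Rightarrow>\<^sub>B 'b::cbanach) \<Rightarrow> 'b dual \<Rightarrow>\<^sub>B 'a dual"
  where "banach_adjoint S = (THE A. \<forall>\<phi>. clop_apply A \<phi> = \<phi> o\<^sub>B S)"

lemma banach_adjoint_apply [simp]: "clop_apply (banach_adjoint S) \<phi> = \<phi> o\<^sub>B S"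
proof -
  have "bounded_linear (\<lambda>\<phi> :: 'b dual. \<phi> o\<^sub>B S)"
    by (rule bounded_linear_intro[where K = "norm S"])
      (auto intro!: clop_eqI norm_clop_compose simp: clop_apply_add clop_apply_scaleR)
  moreover have "(c *\<^sub>C \<phi>) o\<^sub>B S = c *\<^sub>C (\<phi> o\<^sub>B S)" for c and \<phi> :: "'b dual"
    by (rule clop_eqI) (simp add: clop_apply_scaleC)
  ultimately obtain A where A: "clop_apply A = (\<lambda>\<phi> :: 'b dual. \<phi> o\<^sub>B S)"
    using clop_exists by blast
  have "\<forall>\<phi>. clop_apply (banach_adjoint S) \<phi> = \<phi> o\<^sub>B S"
    unfolding banach_adjoint_def by (rule theI[of _ A]) (auto simp: A intro!: clop_eqI)
  then show ?thesis by blast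
qed


section \<open>Spectral notions\<close>

definition spectrum :: "('a::cbanach \<Rightarrow>\<^sub>B 'a) \<Rightarrow> complex set" (\<open>\<sigma>\<close>)
  where "\<sigma> T = {\<mu>. \<not> (\<exists>R. R o\<^sub>B (T - \<mu> *\<^sub>C clop_id) = clop_id \<and> (T - \<mu> *\<^sub>C clop_id) o\<^sub>B R = clop_id)}"

definition point_spectrum :: "('a::cbanach \<Rightarrow>\<^sub>B 'a) \<Rightarrow> complex set" (\<open>\<sigma>\<^sub>p\<close>)
  where "\<sigma>\<^sub>p T = {\<mu>. \<exists>x. x \<noteq> 0 \<and> clop_apply T x = \<mu> *\<^sub>C x}"

definition kappa :: "('a::cbanach \<Rightarrow>\<^sub>B 'a) \<Rightarrow> real" (\<open>\<kappa>\<close>)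
  where "\<kappa> R = Inf {norm (clop_apply R x) | x. norm x = 1}"

text \<open>The limit exists on every non-zero space, since \<open>n \<mapsto> \<kappa> (R ^\<^sub>B n)\<close> is supermultiplicative and
  bounded by \<open>norm R ^ n\<close>.\<close>

definition i_index :: "('a::cbanach \<Rightarrow>\<^sub>B 'a) \<Rightarrow> real"
  where "i_index R = lim (\<lambda>n. root n (\<kappa> (R ^\<^sub>B n)))"


section \<open>J-sets and J-mix-sets\<close>

definition J_set :: "('a::cbanach \<Rightarrow>\<^sub>B 'a) \<Rightarrow> 'a \<Rightarrow> 'a set"
  where "J_set T x = {y. \<exists>(k :: nat \<Rightarrow> nat) X. strict_mono k \<and> X \<longlonglongrightarrow> x \<and>
    (\<lambda>n. clop_apply (T ^\<^sub>B k n) (X n)) \<longlonglongrightarrow> y}"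

definition Jmix_set :: "('a::cbanach \<Rightarrow>\<^sub>B 'a) \<Rightarrow> 'a \<Rightarrow> 'a set"
  where "Jmix_set T x = {y. \<exists>X. X \<longlonglongrightarrow> x \<and> (\<lambda>n. clop_apply (T ^\<^sub>B n) (X n)) \<longlonglongrightarrow> y}"

definition J_class :: "('a::cbanach \<Rightarrow>\<^sub>B 'a) \<Rightarrow> bool"
  where "J_class T \<longleftrightarrow> (\<exists>x. x \<noteq> 0 \<and> J_set T x = UNIV)"

definition Jmix_class :: "('a::cbanach \<Rightarrow>\<^sub>B 'a) \<Rightarrow> bool"
  where "Jmix_class T \<longleftrightarrow> (\<exists>x. x \<noteq> 0 \<and> Jmix_set T x = UNIV)"


section \<open>The sequence space of bounded sequences\<close>

text \<open>The library has completeness only for metric domains, and \<^typ>\<open>nat\<close> carries no metric there.\<close>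

instance bcontfun :: (topological_space, complete_space) complete_space
proof
  fix f :: "nat \<Rightarrow> 'a \<Rightarrow>\<^sub>C 'b"
  assume "Cauchy f"
  have "\<forall>e>0. \<exists>N. \<forall>m n x. N \<le> m \<and> N \<le> n \<and> True \<longrightarrow> dist (apply_bcontfun (f m) x) (apply_bcontfun (f n) x) < e"
  proof (intro allI impI)
    fix e :: real assume "0 < e"
    then obtain N where "\<forall>m\<ge>N. \<forall>n\<ge>N. dist (f m) (f n) < e"
      using \<open>Cauchy f\<close> unfolding Cauchy_def by blast
    then show "\<exists>N. \<forall>m n x. N \<le> m \<and> N \<le> n \<and> True \<longrightarrow>
        dist (apply_bcontfun (f m) x) (apply_bcontfun (f n) x) < e"
      by (blast intro: dist_fun_lt_imp_dist_val_lt)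
  qed
  then obtain g where "\<forall>e>0. \<exists>N. \<forall>n x. N \<le> n \<and> True \<longrightarrow> dist (apply_bcontfun (f n) x) (g x) < e"
    unfolding uniformly_convergent_eq_cauchy[of "\<lambda>_. True" "\<lambda>n. apply_bcontfun (f n)", symmetric] by blast
  then have "uniform_limit UNIV (\<lambda>n. apply_bcontfun (f n)) g sequentially"
    unfolding uniform_limit_sequentially_iff by blast
  from uniform_limit_bcontfunE[OF this sequentially_bot]
  obtain l' where "g = apply_bcontfun l'" "f \<longlonglongrightarrow> l'" by metis
  then show "convergent f"
    by (intro convergentI)
qed

instance bcontfun :: (topological_space, banach) banach ..

instantiation bcontfun :: (topological_space, cbanach) cbanach
begin

definition scaleC_bcontfun :: "complex \<Rightarrow> ('a \<Rightarrow>\<^sub>C 'b) \<Rightarrow> 'a \<Rightarrow>\<^sub>C 'b"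
  where "scaleC_bcontfun c f = Bcontfun (\<lambda>x. c *\<^sub>C apply_bcontfun f x)"

lemma apply_bcontfun_scaleC [simp]: "apply_bcontfun (c *\<^sub>C f) x = c *\<^sub>C apply_bcontfun f x"
proof -
  have "(\<lambda>x. c *\<^sub>C apply_bcontfun f x) \<in> bcontfun"
    by (rule bcontfun_normI[where b = "cmod c * norm f"])
      (auto intro!: bounded_linear.continuous_on[OF bounded_linear_scaleC] mult_left_mono norm_bounded)
  then show ?thesis by (simp add: scaleC_bcontfun_def Bcontfun_inverse)
qed

instance
proof
  fix a b :: complex and r :: real and f g :: "'a \<Rightarrow>\<^sub>C 'b"
  show "a *\<^sub>C (f + g) = a *\<^sub>C f + a *\<^sub>C g" "(a + b) *\<^sub>C f = a *\<^sub>C f + b *\<^sub>C f"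
    "a *\<^sub>C b *\<^sub>C f = (a * b) *\<^sub>C f" "complex_of_real r *\<^sub>C f = r *\<^sub>R f"
    by (auto intro!: bcontfun_eqI simp: scaleC_add_left scaleC_add_right)
  have le: "norm (a *\<^sub>C f) \<le> cmod a * norm f" for a and f :: "'a \<Rightarrow>\<^sub>C 'b"
    by (rule norm_bound) (auto intro!: mult_left_mono norm_bounded)
  show "norm (a *\<^sub>C f) = cmod a * norm f"
  proof (cases "a = 0")
    case True
    then show ?thesis using le[of a f] by simp
  next
    case False
    have "inverse a *\<^sub>C a *\<^sub>C f = f"
      using False by (auto intro!: bcontfun_eqI)
    then have "norm f \<le> cmod (inverse a) * norm (a *\<^sub>C f)"
      using le[of "inverse a" "a *\<^sub>C f"] by simp
    then have "cmod a * norm f \<le> cmod a * (cmod (inverse a) * norm (a *\<^sub>C f))"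
      by (rule mult_left_mono) simp
    also have "\<dots> = norm (a *\<^sub>C f)"
      unfolding mult.assoc[symmetric] norm_mult[symmetric] using False by simp
    finally have "cmod a * norm f \<le> norm (a *\<^sub>C f)" .
    then show ?thesis using le[of a f] by simp
  qed
qed

end

text \<open>
  Every function on \<^typ>\<open>nat\<close> is continuous, so bounded continuous functions on \<^typ>\<open>nat\<close> are
  exactly the bounded sequences, and the norm of \<^typ>\<open>nat \<Rightarrow>\<^sub>C complex\<close> is the sup-norm.
\<close>

type_synonym linf = "nat \<Rightarrow>\<^sub>C complex"

lemma bcontfun_nat_iff: "(f :: nat \<Rightarrow> complex) \<in> bcontfun \<longleftrightarrow> bounded (range f)"
  by (simp add: bcontfun_def)

lemma norm_linf: "norm (f :: linf) = (SUP n. cmod (apply_bcontfun f n))"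
  by (simp add: norm_bcontfun_def dist_bcontfun_def)


section \<open>The sequence space of absolutely summable sequences\<close>

typedef l1 = "{x :: nat \<Rightarrow> complex. summable (\<lambda>n. cmod (x n))}"
  morphisms l1_nth Abs_l1
  by (rule exI[of _ "\<lambda>_. 0"]) simp

setup_lifting type_definition_l1

lemma l1_eqI: "(\<And>n. l1_nth x n = l1_nth y n) \<Longrightarrow> x = y"
  by transfer auto

lemma summable_norm_l1 [simp]: "summable (\<lambda>n. cmod (l1_nth x n))"
  by transfer

lemma summable_cmod_add:
  "summable (\<lambda>n. cmod (x n)) \<Longrightarrow> summable (\<lambda>n. cmod (y n)) \<Longrightarrow> summable (\<lambda>n. cmod (x n + y n))"
  by (rule summable_comparison_test'[where N = 0, OF summable_add[of "\<lambda>n. cmod (x n)" "\<lambda>n. cmod (y n)"]])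
    (auto intro: norm_triangle_ineq)

lemma summable_cmod_diff:
  "summable (\<lambda>n. cmod (x n)) \<Longrightarrow> summable (\<lambda>n. cmod (y n)) \<Longrightarrow> summable (\<lambda>n. cmod (x n - y n))"
  using summable_cmod_add[of x "\<lambda>n. - y n"] by simp

instantiation l1 :: real_normed_vector
begin

lift_definition zero_l1 :: l1 is "\<lambda>_. 0" by simp
lift_definition plus_l1 :: "l1 \<Rightarrow> l1 \<Rightarrow> l1" is "\<lambda>x y n. x n + y n"
  by (rule summable_cmod_add)
lift_definition uminus_l1 :: "l1 \<Rightarrow> l1" is "\<lambda>x n. - x n" by simp
lift_definition minus_l1 :: "l1 \<Rightarrow> l1 \<Rightarrow> l1" is "\<lambda>x y n. x n - y n"
  by (rule summable_cmod_diff)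
lift_definition scaleR_l1 :: "real \<Rightarrow> l1 \<Rightarrow> l1" is "\<lambda>r x n. r *\<^sub>R x n"
  by (simp add: summable_mult)
definition norm_l1 :: "l1 \<Rightarrow> real" where "norm_l1 x = (\<Sum>n. cmod (l1_nth x n))"
definition dist_l1 :: "l1 \<Rightarrow> l1 \<Rightarrow> real" where "dist_l1 x y = norm (x - y)"
definition sgn_l1 :: "l1 \<Rightarrow> l1" where "sgn_l1 x = inverse (norm x) *\<^sub>R x"
definition uniformity_l1 :: "(l1 \<times> l1) filter"
  where "uniformity_l1 = (INF e\<in>{0 <..}. principal {(x, y). dist x y < e})"
definition open_l1 :: "l1 set \<Rightarrow> bool"
  where "open_l1 S = (\<forall>x\<in>S. \<forall>\<^sub>F (x', y) in uniformity. x' = x \<longrightarrow> y \<in> S)"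

instance
proof
  fix x y :: l1 and a :: real
  show "norm x = 0 \<longleftrightarrow> x = 0"
    unfolding norm_l1_def by transfer (auto simp: suminf_eq_zero_iff)
  show "norm (x + y) \<le> norm x + norm y"
    unfolding norm_l1_def
    apply transfer
    apply (subst suminf_add)
      apply assumption+
    apply (rule suminf_le)
      apply (auto intro: norm_triangle_ineq summable_cmod_add summable_add)
    done
  show "norm (a *\<^sub>R x) = \<bar>a\<bar> * norm x"
    unfolding norm_l1_def by transfer (simp add: suminf_mult)
qed (simp_all add: dist_l1_def sgn_l1_def uniformity_l1_def open_l1_def,
    (transfer; simp add: algebra_simps)+)

end

lemma l1_nth_simps [simp]:
  "l1_nth 0 n = 0" "l1_nth (x + y) n = l1_nth x n + l1_nth y n"
  "l1_nth (x - y) n = l1_nth x n - l1_nth y n" "l1_nth (r *\<^sub>R x) n = r *\<^sub>R l1_nth x n"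
  by (transfer; simp)+

lemma sum_cmod_le_norm_l1: "(\<Sum>k<n. cmod (l1_nth x k)) \<le> norm x"
  unfolding norm_l1_def by (rule sum_le_suminf) auto

lemma cmod_l1_nth_le: "cmod (l1_nth x n) \<le> norm x"
proof -
  have "cmod (l1_nth x n) \<le> (\<Sum>k<Suc n. cmod (l1_nth x k))"
    by (simp add: sum_nonneg)
  then show ?thesis using sum_cmod_le_norm_l1[of x "Suc n"] by linarith
qed

lemma summable_norm_l1_bound:
  assumes "\<And>n. (\<Sum>k<n. cmod (f k)) \<le> e"
  shows "summable (\<lambda>n. cmod (f n))" "(\<Sum>n. cmod (f n)) \<le> e"
proof -
  show s: "summable (\<lambda>n. cmod (f n))"
    by (rule summableI_nonneg_bounded[of _ e]) (use assms in auto)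
  show "(\<Sum>n. cmod (f n)) \<le> e"
    by (rule suminf_le_const[OF s]) (use assms in auto)
qed

instance l1 :: banach
proof
  fix X :: "nat \<Rightarrow> l1"
  assume X: "Cauchy X"
  have "Cauchy (\<lambda>m. l1_nth (X m) k)" for k
  proof (rule CauchyI)
    fix e :: real assume "0 < e"
    from CauchyD[OF X this] obtain M where M: "\<forall>m\<ge>M. \<forall>n\<ge>M. norm (X m - X n) < e" by blast
    have "norm (l1_nth (X m) k - l1_nth (X n) k) \<le> norm (X m - X n)" for m n
      using cmod_l1_nth_le[of "X m - X n" k] by simp
    then show "\<exists>M. \<forall>m\<ge>M. \<forall>n\<ge>M. norm (l1_nth (X m) k - l1_nth (X n) k) < e"
      using M by (meson le_less_trans)
  qed
  then have "\<forall>k. \<exists>l. (\<lambda>m. l1_nth (X m) k) \<longlonglongrightarrow> l"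
    by (auto simp: Cauchy_convergent_iff convergent_def)
  then obtain a where a: "\<And>k. (\<lambda>m. l1_nth (X m) k) \<longlonglongrightarrow> a k"
    by metis
  have tail: "\<exists>N. \<forall>n\<ge>N. \<forall>K. (\<Sum>k<K. cmod (a k - l1_nth (X n) k)) \<le> e" if "0 < e" for e
  proof -
    from CauchyD[OF X \<open>0 < e\<close>] obtain N where N: "\<forall>m\<ge>N. \<forall>n\<ge>N. norm (X m - X n) < e" by blast
    have "(\<Sum>k<K. cmod (a k - l1_nth (X n) k)) \<le> e" if "n \<ge> N" for n K
    proof (rule LIMSEQ_le_const2)
      show "(\<lambda>m. \<Sum>k<K. cmod (l1_nth (X m) k - l1_nth (X n) k))
          \<longlonglongrightarrow> (\<Sum>k<K. cmod (a k - l1_nth (X n) k))"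
        by (intro tendsto_intros a)
      have "(\<Sum>k<K. cmod (l1_nth (X m) k - l1_nth (X n) k)) \<le> e" if "m \<ge> N" for m
        using sum_cmod_le_norm_l1[of "X m - X n" K] N that \<open>n \<ge> N\<close> by (fastforce intro: less_imp_le)
      then show "\<exists>M. \<forall>m\<ge>M. (\<Sum>k<K. cmod (l1_nth (X m) k - l1_nth (X n) k)) \<le> e"
        by blast
    qed
    then show ?thesis by blast
  qed
  obtain N where N: "\<And>n K. n \<ge> N \<Longrightarrow> (\<Sum>k<K. cmod (a k - l1_nth (X n) k)) \<le> 1"
    using tail[of 1] by auto
  have "summable (\<lambda>k. cmod ((a k - l1_nth (X N) k) + l1_nth (X N) k))"
    by (rule summable_cmod_add[OF summable_norm_l1_bound(1)]) (use N in auto)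
  then obtain A where A: "l1_nth A = a"
    using Abs_l1_inverse[of a] by auto
  have "X \<longlonglongrightarrow> A"
  proof (rule LIMSEQ_I)
    fix r :: real assume "0 < r"
    then obtain N where N: "\<And>n K. n \<ge> N \<Longrightarrow> (\<Sum>k<K. cmod (a k - l1_nth (X n) k)) \<le> r / 2"
      using tail[of "r / 2"] by auto
    have "norm (X n - A) < r" if "n \<ge> N" for n
    proof -
      have "norm (A - X n) \<le> r / 2"
        unfolding norm_l1_def using summable_norm_l1_bound(2)[OF N[OF that]] by (simp add: A)
      then show ?thesis using \<open>0 < r\<close> by (simp add: norm_minus_commute)
    qed
    then show "\<exists>N. \<forall>n\<ge>N. norm (X n - A) < r" by blast
  qed
  then show "convergent X" by (rule convergentI)
qed

instantiation l1 :: cbanach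
begin

lift_definition scaleC_l1 :: "complex \<Rightarrow> l1 \<Rightarrow> l1" is "\<lambda>c x n. c * x n"
  by (simp add: norm_mult summable_mult)

instance
proof
  fix a b :: complex and r :: real and x y :: l1
  show "a *\<^sub>C (x + y) = a *\<^sub>C x + a *\<^sub>C y" "(a + b) *\<^sub>C x = a *\<^sub>C x + b *\<^sub>C x"
    "a *\<^sub>C b *\<^sub>C x = (a * b) *\<^sub>C x" "complex_of_real r *\<^sub>C x = r *\<^sub>R x"
    by (transfer; simp add: algebra_simps scaleR_conv_of_real)+
  show "norm (a *\<^sub>C x) = cmod a * norm x"
    unfolding norm_l1_def by transfer (simp add: norm_mult suminf_mult)
qed

end

lemma l1_nth_scaleC [simp]: "l1_nth (c *\<^sub>C x) n = c * l1_nth x n"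
  by transfer simp


section \<open>The duality between the two sequence spaces\<close>

text \<open>The canonical (bilinear) identification of a bounded sequence with a functional on \<open>l1\<close>.\<close>

lemma summable_pairing:
  "summable (\<lambda>n. cmod (l1_nth x n * apply_bcontfun f n))"
  "(\<Sum>n. cmod (l1_nth x n * apply_bcontfun f n)) \<le> norm f * norm x"
proof -
  have le: "cmod (l1_nth x n * apply_bcontfun f n) \<le> norm f * cmod (l1_nth x n)" for n
    using mult_left_mono[OF norm_bounded[of f n], of "cmod (l1_nth x n)"]
    by (simp add: norm_mult mult.commute)
  have s: "summable (\<lambda>n. norm f * cmod (l1_nth x n))"
    by (intro summable_mult summable_norm_l1)
  show 1: "summable (\<lambda>n. cmod (l1_nth x n * apply_bcontfun f n))"
    by (rule summable_comparison_test'[OF s, of 0]) (use le in auto)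
  have "(\<Sum>n. cmod (l1_nth x n * apply_bcontfun f n)) \<le> (\<Sum>n. norm f * cmod (l1_nth x n))"
    by (rule suminf_le[OF le 1 s])
  also have "\<dots> = norm f * norm x"
    by (simp add: norm_l1_def suminf_mult)
  finally show "(\<Sum>n. cmod (l1_nth x n * apply_bcontfun f n)) \<le> norm f * norm x" .
qed

definition linf_functional :: "linf \<Rightarrow> l1 dual"
  where "linf_functional f =
    (THE \<phi>. \<forall>x. clop_apply \<phi> x = (\<Sum>n. l1_nth x n * apply_bcontfun f n))"

lemma linf_functional_apply:
  "clop_apply (linf_functional f) x = (\<Sum>n. l1_nth x n * apply_bcontfun f n)"
proof -
  note s = summable_norm_cancel[OF summable_pairing(1)]
  have "bounded_linear (\<lambda>x. \<Sum>n. l1_nth x n * apply_bcontfun f n)"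
  proof (rule bounded_linear_intro[where K = "norm f"])
    fix x y :: l1 and r :: real
    show "(\<Sum>n. l1_nth (x + y) n * apply_bcontfun f n)
        = (\<Sum>n. l1_nth x n * apply_bcontfun f n) + (\<Sum>n. l1_nth y n * apply_bcontfun f n)"
      by (subst suminf_add[OF s s]) (simp add: distrib_right)
    show "(\<Sum>n. l1_nth (r *\<^sub>R x) n * apply_bcontfun f n) = r *\<^sub>R (\<Sum>n. l1_nth x n * apply_bcontfun f n)"
      using suminf_scaleR_right[OF s, of r x f] by simp
    show "norm (\<Sum>n. l1_nth x n * apply_bcontfun f n) \<le> norm x * norm f"
      using order_trans[OF summable_norm[OF summable_pairing(1)] summable_pairing(2), of x f]
      by (simp add: mult.commute)
  qed
  moreover have "(\<Sum>n. l1_nth (c *\<^sub>C x) n * apply_bcontfun f n)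
      = c *\<^sub>C (\<Sum>n. l1_nth x n * apply_bcontfun f n)" for c x
    using suminf_mult[OF s, of c x f] by (simp add: mult.assoc)
  ultimately obtain F where F: "clop_apply F = (\<lambda>x. \<Sum>n. l1_nth x n * apply_bcontfun f n)"
    using clop_exists by blast
  have "\<forall>x. clop_apply (linf_functional f) x = (\<Sum>n. l1_nth x n * apply_bcontfun f n)"
    unfolding linf_functional_def by (rule theI[of _ F]) (auto simp: F intro!: clop_eqI)
  then show ?thesis by blast
qed

lift_definition l1_unit :: "nat \<Rightarrow> l1" is "\<lambda>k n. if n = k then 1 else 0"
  by (rule summable_finite[of "{k}" for k]) auto

lemma l1_nth_unit: "l1_nth (l1_unit k) n = (if n = k then 1 else 0)"
  by transfer simp

lemma norm_l1_unit [simp]: "norm (l1_unit k) = 1"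
  unfolding norm_l1_def l1_nth_unit
  using suminf_finite[of "{k}" "\<lambda>n. cmod (if n = k then 1 else 0)"] by simp

lemma linf_functional_unit: "clop_apply (linf_functional f) (l1_unit k) = apply_bcontfun f k"
  unfolding linf_functional_apply l1_nth_unit
  by (subst suminf_finite[of "{k}"]) auto

lemma l1_unit_expansion: "(\<lambda>K. \<Sum>k<K. l1_nth x k *\<^sub>C l1_unit k) \<longlonglongrightarrow> x"
proof -
  have nth: "l1_nth (\<Sum>k<K. l1_nth x k *\<^sub>C l1_unit k) n = (if n < K then l1_nth x n else 0)" for K n
  proof (induction K)
    case (Suc K)
    then show ?case by (auto simp: l1_nth_unit less_Suc_eq)
  qed simp
  have "norm (x - (\<Sum>k<K. l1_nth x k *\<^sub>C l1_unit k)) = (\<Sum>n. cmod (l1_nth x (n + K)))" for K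
  proof -
    have "norm (x - (\<Sum>k<K. l1_nth x k *\<^sub>C l1_unit k))
        = (\<Sum>n. if n < K then 0 else cmod (l1_nth x n))"
      unfolding norm_l1_def by (rule arg_cong[of _ _ suminf]) (auto simp: nth)
    also have "\<dots> = (\<Sum>n. if n + K < K then 0 else cmod (l1_nth x (n + K)))
        + (\<Sum>n<K. if n < K then 0 else cmod (l1_nth x n))"
    proof (rule suminf_split_initial_segment)
      show "summable (\<lambda>n. if n < K then 0 else cmod (l1_nth x n))"
        by (rule summable_comparison_test'[OF summable_norm_l1[of x], of 0]) auto
    qed
    finally show ?thesis by simp
  qed
  then have "(\<lambda>K. norm (x - (\<Sum>k<K. l1_nth x k *\<^sub>C l1_unit k))) \<longlonglongrightarrow> 0"
    using suminf_exist_split2[OF summable_norm_l1[of x]] by simp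
  then have "(\<lambda>K. x - (\<Sum>k<K. l1_nth x k *\<^sub>C l1_unit k)) \<longlonglongrightarrow> 0"
    by (rule tendsto_norm_zero_cancel)
  from tendsto_diff[OF tendsto_const[of x] this] show ?thesis by simp
qed

lemma norm_linf_functional: "norm (linf_functional f) = norm f"
proof (rule antisym)
  show "norm (linf_functional f) \<le> norm f"
    unfolding norm_clop_def
    using order_trans[OF summable_norm[OF summable_pairing(1)] summable_pairing(2), of _ f]
    by (intro norm_clop_bound[unfolded norm_clop_def]) (auto simp: linf_functional_apply)
  show "norm f \<le> norm (linf_functional f)"
    using norm_clop_le[of "linf_functional f" "l1_unit k" for k]
    by (intro norm_bound) (simp add: linf_functional_unit)
qed

text \<open>Together with \<open>norm_linf_functional\<close>: \<^typ>\<open>linf\<close> is isometrically the dual of \<^typ>\<open>l1\<close>.\<close>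

lemma bij_linf_functional: "bij linf_functional"
proof (rule bijI)
  show "inj linf_functional"
    by (rule injI, rule bcontfun_eqI) (metis linf_functional_unit)
  show "surj linf_functional"
  proof (rule surjI)
    fix \<phi> :: "l1 dual"
    define f where "f = Bcontfun (\<lambda>k. clop_apply \<phi> (l1_unit k))"
    have "(\<lambda>k. clop_apply \<phi> (l1_unit k)) \<in> bcontfun"
      using norm_clop_le[of \<phi> "l1_unit k" for k] by (intro bcontfun_normI[of _ "norm \<phi>"]) auto
    then have f: "apply_bcontfun f k = clop_apply \<phi> (l1_unit k)" for k
      by (simp add: f_def Bcontfun_inverse)
    show "linf_functional (Bcontfun (\<lambda>k. clop_apply \<phi> (l1_unit k))) = \<phi>"
    proof (rule clop_eqI)
      fix x
      have lim: "(\<lambda>K. clop_apply \<psi> (\<Sum>k<K. l1_nth x k *\<^sub>C l1_unit k)) \<longlonglongrightarrow> clop_apply \<psi> x" for \<psi> :: "l1 dual"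
        by (rule bounded_linear.tendsto[OF bounded_linear_clop_apply l1_unit_expansion])
      have eq: "clop_apply \<psi> (\<Sum>k<K. l1_nth x k *\<^sub>C l1_unit k)
          = (\<Sum>k<K. l1_nth x k * clop_apply \<psi> (l1_unit k))" for \<psi> :: "l1 dual" and K
        by (simp add: linear_sum[OF bounded_linear.linear[OF bounded_linear_clop_apply]] clop_scaleC)
      show "clop_apply (linf_functional (Bcontfun (\<lambda>k. clop_apply \<phi> (l1_unit k)))) x = clop_apply \<phi> x"
        using lim[of \<phi>] lim[of "linf_functional f"]
        by (auto simp: eq linf_functional_unit f f_def[symmetric] intro: LIMSEQ_unique)
    qed
  qed
qed

text \<open>\<open>T = S\<^sup>*\<close>, read through the identification of \<^typ>\<open>linf\<close> with the dual of \<^typ>\<open>l1\<close>.\<close>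

definition is_adjoint_of :: "(linf \<Rightarrow>\<^sub>B linf) \<Rightarrow> (l1 \<Rightarrow>\<^sub>B l1) \<Rightarrow> bool"
  where "is_adjoint_of T S \<longleftrightarrow>
    (\<forall>f. linf_functional (clop_apply T f) = clop_apply (banach_adjoint S) (linf_functional f))"

end

(*
  The statements (i) to (vi) are linked by i(S). If S - \<mu> is bounded below, the Hahn-Banach theorem makes
  T - \<mu> onto with a norm bound on preimages, so \<mu> is no eigenvalue of the adjoint T' of T. If S - \<mu> is
  not bounded below, there are unit vectors x_n with (S - \<mu>) x_n \<longrightarrow> 0; by Schur's theorem they are not
  weakly null, and a generalized limit of f \<mapsto> <x_n, f> is an eigenvector of T' for \<mu>. Hence \<sigma>_p(T')
  misses the closed disc iff S - \<mu> is bounded below for all |\<mu>| \<le> 1, by compactness uniformly in \<mu>.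
  This is equivalent to i(S) > 1: one direction is a Cauchy estimate over roots of unity, the other is the factorization of
  S^n - \<mu>^n.

  If i(S) > 1, each y has preimages under T^n tending to 0, and adding them to a kernel vector x of T gives
  J^mix(x) = X; without a kernel vector, T^n is expanding and J(x) is empty for x \<noteq> 0. An eigenvalue of T'
  in the closed disc makes the modulus of its eigenfunctional constant on J(x), which then has empty
  interior. Kernels of T - \<mu> spread over the disc, because all T - \<mu> are onto with a common bound.
*)

theory Submission
  imports Defs
begin

section \<open>The Hahn--Banach theorem\<close>

text \<open>One-sided homogeneity is easier to verify for infima. Equality for positive
  \<open>r\<close> follows by applying it to \<open>r\<close> and to its inverse;
  \<open>sublinear_zero\<close> covers the origin.\<close>

definition sublinear :: "('a::real_vector \<Rightarrow> real) \<Rightarrow> bool"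
  where "sublinear p \<longleftrightarrow> (\<forall>x y. p (x + y) \<le> p x + p y) \<and> (\<forall>r x. 0 \<le> r \<longrightarrow> p (r *\<^sub>R x) \<le> r * p x)"

lemma sublinearI:
  assumes "\<And>x y. p (x + y) \<le> p x + p y" "\<And>r x. 0 \<le> r \<Longrightarrow> p (r *\<^sub>R x) \<le> r * p x"
  shows "sublinear p"
  using assms by (simp add: sublinear_def)

lemma sublinear_add: "sublinear p \<Longrightarrow> p (x + y) \<le> p x + p y"
  by (simp add: sublinear_def)

lemma sublinear_scaleR: "sublinear p \<Longrightarrow> 0 \<le> r \<Longrightarrow> p (r *\<^sub>R x) \<le> r * p x"
  by (simp add: sublinear_def)

lemma sublinear_zero: "sublinear p \<Longrightarrow> p 0 = 0"
  using sublinear_add[of p 0 0] sublinear_scaleR[of p 0 0] by auto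

lemma sublinear_diff: "sublinear p \<Longrightarrow> p x - p (- y) \<le> p (x + y)"
  using sublinear_add[of p "x + y" "- y"] by simp

text \<open>Serves three infima: over a chain, over non-negative multiples of a vector, and over the
  domain of a linear map. Since \<open>k\<close> may depend on the points, chains fit as well as
  index sets closed under addition and scaling. The bound \<open>B\<close> makes the infima genuine
  lower limits.\<close>

lemma sublinear_INF:
  fixes F :: "'i \<Rightarrow> 'a::real_vector \<Rightarrow> real"
  assumes ne: "I \<noteq> {}"
    and below: "\<And>i x. i \<in> I \<Longrightarrow> B x \<le> F i x"
    and add: "\<And>i j x y. i \<in> I \<Longrightarrow> j \<in> I \<Longrightarrow> \<exists>k\<in>I. F k (x + y) \<le> F i x + F j y"
    and scale: "\<And>i r x. i \<in> I \<Longrightarrow> 0 \<le> r \<Longrightarrow> \<exists>k\<in>I. F k (r *\<^sub>R x) \<le> r * F i x"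
  shows "sublinear (\<lambda>x. INF i\<in>I. F i x)"
proof (rule sublinearI)
  have bdd: "bdd_below ((\<lambda>i. F i x) ` I)" for x
    using below by (intro bdd_belowI2) auto
  have low: "(INF i\<in>I. F i x) \<le> F i x" if "i \<in> I" for i x
    by (rule cINF_lower[OF bdd that])
  fix x y
  have "(INF i\<in>I. F i (x + y)) - F j y \<le> (INF i\<in>I. F i x)" if "j \<in> I" for j
  proof (rule cINF_greatest[OF ne])
    fix i assume "i \<in> I"
    then obtain k where "k \<in> I" "F k (x + y) \<le> F i x + F j y" using add[OF _ \<open>j \<in> I\<close>] by blast
    then show "(INF i\<in>I. F i (x + y)) - F j y \<le> F i x"
      using low[of k "x + y"] by linarith
  qed
  then have "(INF i\<in>I. F i (x + y)) - (INF i\<in>I. F i x) \<le> (INF j\<in>I. F j y)"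
    by (intro cINF_greatest[OF ne]) (simp add: algebra_simps)
  then show "(INF i\<in>I. F i (x + y)) \<le> (INF i\<in>I. F i x) + (INF i\<in>I. F i y)" by linarith
next
  fix r :: real and x :: 'a assume r: "0 \<le> r"
  have bdd: "bdd_below ((\<lambda>i. F i x) ` I)" for x
    using below by (intro bdd_belowI2) auto
  have *: "(INF i\<in>I. F i (r *\<^sub>R x)) \<le> r * F i x" if i: "i \<in> I" for i
  proof -
    obtain k where "k \<in> I" "F k (r *\<^sub>R x) \<le> r * F i x" using scale[OF i r] by blast
    then show ?thesis using cINF_lower[OF bdd, of k "r *\<^sub>R x"] by linarith
  qed
  show "(INF i\<in>I. F i (r *\<^sub>R x)) \<le> r * (INF i\<in>I. F i x)"
  proof (cases "r = 0")
    case True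
    obtain i where "i \<in> I" using ne by blast
    from *[OF this] show ?thesis by (simp add: True)
  next
    case False
    then have "0 < r" using r by simp
    then have "(INF i\<in>I. F i (r *\<^sub>R x)) / r \<le> (INF i\<in>I. F i x)"
      using * by (intro cINF_greatest[OF ne]) (simp add: field_simps)
    then show ?thesis using \<open>0 < r\<close> by (simp add: field_simps)
  qed
qed

text \<open>Zorn's lemma for the reversed pointwise order: the infimum of a non-empty chain is again
  sublinear and lies below \<open>p\<close>.\<close>

lemma minimal_sublinear:
  assumes "sublinear p"
  obtains q where "sublinear q" "q \<le> p" "\<And>q'. sublinear q' \<Longrightarrow> q' \<le> q \<Longrightarrow> q' = q"
proof -
  define A where "A = {q. sublinear q \<and> q \<le> p}"
  have "\<exists>m\<in>A. \<forall>a\<in>A. a \<le> m \<longrightarrow> a = m"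
  proof (rule predicate_Zorn)
    show "partial_order_on A (relation_of (\<lambda>a b. b \<le> a) A)"
      by (rule partial_order_on_relation_ofI) auto
    fix C assume "C \<in> Chains (relation_of (\<lambda>a b. b \<le> a) A)"
    then have CA: "C \<subseteq> A" and chain: "\<And>a b. a \<in> C \<Longrightarrow> b \<in> C \<Longrightarrow> a \<le> b \<or> b \<le> a"
      by (auto simp: Chains_def relation_of_def)
    show "\<exists>u\<in>A. \<forall>a\<in>C. u \<le> a"
    proof (cases "C = {}")
      case True
      then show ?thesis using assms by (auto simp: A_def)
    next
      case False
      define u where "u x = (INF q\<in>C. q x)" for x
      have C: "sublinear q" "q \<le> p" if "q \<in> C" for q
        using CA that by (auto simp: A_def)
      \<comment> \<open>From \<open>0 = q 0 <= q x + q (- x) <= q x + p (- x)\<close>; the bound is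
        the same for all members of the chain.\<close>
      have below: "- p (- x) \<le> q x" if "q \<in> C" for q x
        using sublinear_diff[OF C(1)[OF that], of 0 x] sublinear_zero[OF C(1)[OF that]]
          le_funD[OF C(2)[OF that], of "- x"] by simp
      have "sublinear u"
        unfolding u_def
      proof (rule sublinear_INF[OF False below])
        fix i j :: "'a \<Rightarrow> real" and x y assume ij: "i \<in> C" "j \<in> C"
        from chain[OF ij] show "\<exists>k\<in>C. k (x + y) \<le> i x + j y"
        proof
          assume "i \<le> j"
          then show ?thesis
            using ij sublinear_add[OF C(1)[OF ij(1)], of x y] le_funD[of i j y]
            by (intro bexI[of _ i]) auto
        next
          assume "j \<le> i"
          then show ?thesis
            using ij sublinear_add[OF C(1)[OF ij(2)], of x y] le_funD[of j i x]
            by (intro bexI[of _ j]) auto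
        qed
      next
        fix i r x assume "i \<in> C" "0 \<le> (r::real)"
        then show "\<exists>k\<in>C. k (r *\<^sub>R x) \<le> r * i x"
          using sublinear_scaleR[OF C(1)] by blast
      qed
      moreover have low: "u \<le> q" if "q \<in> C" for q
        unfolding u_def by (rule le_funI, rule cINF_lower[OF _ that], rule bdd_belowI2, rule below)
      moreover have "u \<le> p"
        using False low C(2) order_trans by blast
      ultimately show ?thesis by (auto simp: A_def)
    qed
  qed
  then show thesis using that by (auto simp: A_def intro: order_trans)
qed

text \<open>The infimum \<open>q'\<close> of \<open>q (x + t y) - t q y\<close> over
  \<open>t >= 0\<close> is sublinear and at most \<open>q\<close>, so minimality gives
  \<open>q' = q\<close>. Taking \<open>t = 1\<close> then yields superadditivity of
  \<open>q\<close>, the missing half of additivity.\<close>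

lemma minimal_sublinear_linear:
  assumes q: "sublinear q" and min: "\<And>q'. sublinear q' \<Longrightarrow> q' \<le> q \<Longrightarrow> q' = q"
  shows "linear q"
proof -
  have "q x + q y \<le> q (x + y)" for x y
  proof -
    define q' where "q' x = (INF t\<in>{0..}. q (x + t *\<^sub>R y) - t * q y)" for x
    have below: "- q (- x) \<le> q (x + t *\<^sub>R y) - t * q y" if "t \<in> {0..}" for t x
    proof (cases "t = 0")
      case True
      then show ?thesis using sublinear_diff[OF q, of 0 x] sublinear_zero[OF q] by simp
    next
      case False
      then have t: "0 < t" using that by simp
      then have "q y \<le> (1 / t) * q (t *\<^sub>R y)"
        using sublinear_scaleR[OF q, of "1 / t" "t *\<^sub>R y"] by simp
      then have "t * q y \<le> q (t *\<^sub>R y)" using t by (simp add: field_simps)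
      then show ?thesis
        using sublinear_add[OF q, of "x + t *\<^sub>R y" "- x"] by simp
    qed
    have "sublinear q'"
      unfolding q'_def
    proof (rule sublinear_INF[OF _ below])
      fix i j :: real and u v assume ij: "i \<in> {0..}" "j \<in> {0..}"
      have "q (u + v + (i + j) *\<^sub>R y) \<le> q (u + i *\<^sub>R y) + q (v + j *\<^sub>R y)"
        using sublinear_add[OF q, of "u + i *\<^sub>R y" "v + j *\<^sub>R y"] by (simp add: algebra_simps)
      then show "\<exists>k\<in>{0..}. q (u + v + k *\<^sub>R y) - k * q y
          \<le> q (u + i *\<^sub>R y) - i * q y + (q (v + j *\<^sub>R y) - j * q y)"
        using ij by (intro bexI[of _ "i + j"]) (auto simp: algebra_simps)
    next
      fix i r :: real and u assume "i \<in> {0..}" "0 \<le> r"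
      then show "\<exists>k\<in>{0..}. q (r *\<^sub>R u + k *\<^sub>R y) - k * q y \<le> r * (q (u + i *\<^sub>R y) - i * q y)"
        using sublinear_scaleR[OF q, of r "u + i *\<^sub>R y"]
        by (intro bexI[of _ "r * i"]) (auto simp: algebra_simps)
    qed auto
    moreover have low: "q' u \<le> q (u + t *\<^sub>R y) - t * q y" if "0 \<le> t" for t u
      unfolding q'_def using that by (intro cINF_lower bdd_belowI2[OF below]) auto
    moreover have "q' \<le> q" using low[of 0] by (intro le_funI) simp
    ultimately have "q' = q" using min by blast
    then show ?thesis using low[of 1 x] by simp
  qed
  then have add: "q (x + y) = q x + q y" for x y
    using sublinear_add[OF q, of x y] by (simp add: antisym)
  have neg: "q (- x) = - q x" for x
    using add[of x "- x"] sublinear_zero[OF q] by simp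
  have pos: "q (r *\<^sub>R x) = r * q x" if "0 \<le> r" for r x
    using sublinear_scaleR[OF q that, of x] sublinear_scaleR[OF q that, of "- x"] by (simp add: neg)
  have "q (r *\<^sub>R x) = r * q x" for r x
  proof (cases "0 \<le> r")
    case False
    then show ?thesis using pos[of "- r" x] by (simp add: neg)
  qed (rule pos)
  then show ?thesis by (intro linearI) (auto simp: add)
qed

text \<open>The functional is prescribed through a map \<open>R\<close> instead of on a subspace;
  \<open>f <= p o R\<close> forces \<open>f\<close> to vanish on the kernel of \<open>R\<close>. Any
  linear \<open>g\<close> below the infimum \<open>p'\<close> has \<open>g (R x) <= f x\<close>, and
  replacing \<open>x\<close> by \<open>- x\<close> gives equality.\<close>

lemma hahn_banach_real:
  fixes R :: "'b::real_vector \<Rightarrow> 'a::real_vector" and f :: "'b \<Rightarrow> real"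
  assumes p: "sublinear p" and R: "linear R" and f: "linear f" and le: "\<And>x. f x \<le> p (R x)"
  obtains g where "linear g" "\<And>y. g y \<le> p y" "\<And>x. g (R x) = f x"
proof -
  define p' where "p' y = (INF x. p (y - R x) + f x)" for y
  have below: "- p (- y) \<le> p (y - R x) + f x" for x y
  proof -
    have "- f x \<le> p (- R x)" using le[of "- x"] by (simp add: linear_neg[OF f] linear_neg[OF R])
    then show ?thesis using sublinear_add[OF p, of "y - R x" "- y"] by simp
  qed
  have low: "p' y \<le> p (y - R x) + f x" for x y
    unfolding p'_def by (intro cINF_lower bdd_belowI2[OF below]) auto
  have "sublinear p'"
    unfolding p'_def
  proof (rule sublinear_INF[OF _ below])
    fix i j u v
    show "\<exists>k\<in>UNIV. p (u + v - R k) + f k \<le> p (u - R i) + f i + (p (v - R j) + f j)"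
      using sublinear_add[OF p, of "u - R i" "v - R j"]
      by (intro bexI[of _ "i + j"]) (auto simp: linear_add[OF R] linear_add[OF f] algebra_simps)
  next
    fix i u and r :: real assume "0 \<le> r"
    then show "\<exists>k\<in>UNIV. p (r *\<^sub>R u - R k) + f k \<le> r * (p (u - R i) + f i)"
      using sublinear_scaleR[OF p, of r "u - R i"]
      by (intro bexI[of _ "r *\<^sub>R i"]) (auto simp: linear_scale[OF R] linear_scale[OF f] algebra_simps)
  qed auto
  then obtain g where g: "sublinear g" "g \<le> p'" "\<And>q'. sublinear q' \<Longrightarrow> q' \<le> g \<Longrightarrow> q' = g"
    using minimal_sublinear by blast
  have lin: "linear g" by (rule minimal_sublinear_linear[OF g(1,3)])
  have "g (R x) \<le> f x" for x
    using le_funD[OF g(2), of "R x"] low[of "R x" x] sublinear_zero[OF p] by simp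
  moreover from this[of "- x" for x] have "f x \<le> g (R x)" for x
    by (simp add: linear_neg[OF f] linear_neg[OF R] linear_neg[OF lin])
  ultimately have "g (R x) = f x" for x by (simp add: antisym)
  moreover have "g y \<le> p y" for y
    using le_funD[OF g(2), of y] low[of y 0] by (simp add: linear_0[OF R] linear_0[OF f])
  ultimately show thesis using that lin by blast
qed

section \<open>The complex extension theorem and generalized limits\<close>

lemma scaleC_minus_left: "(- a) *\<^sub>C x = - (a *\<^sub>C (x :: 'a::cbanach))"
  using scaleC_add_left[of a "- a" x] by (simp add: eq_neg_iff_add_eq_0 add.commute)

lemma scaleC_diff_left: "(a - b) *\<^sub>C x = a *\<^sub>C x - b *\<^sub>C (x :: 'a::cbanach)"
  using scaleC_add_left[of a "- b" x] by (simp add: scaleC_minus_left)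

text \<open>The real part of \<open>f\<close> is extended to \<open>g\<close>, and
  \<open>g y - i g (i y)\<close> is the complex-linear functional with real part \<open>g\<close>.
  Its modulus obeys the bound \<open>p\<close> because a unimodular factor rotates
  \<open>h y\<close> onto the positive axis; \<open>K\<close> supplies continuity.\<close>

lemma hahn_banach_complex:
  fixes R :: "'b::cbanach \<Rightarrow> 'a::cbanach" and f :: "'b \<Rightarrow> complex"
  assumes p_add: "\<And>x y. p (x + y) \<le> p x + p y" and p_scale: "\<And>c x. p (c *\<^sub>C x) \<le> cmod c * p x"
    and p_bound: "\<And>x. p x \<le> K * norm x"
    and R: "linear R" "\<And>c x. R (c *\<^sub>C x) = c *\<^sub>C R x"
    and f: "linear f" "\<And>c x. f (c *\<^sub>C x) = c * f x"
    and le: "\<And>x. cmod (f x) \<le> p (R x)"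
  obtains h :: "'a dual" where "\<And>y. cmod (clop_apply h y) \<le> p y" "\<And>x. clop_apply h (R x) = f x"
proof -
  have "sublinear p"
    using p_scale[of "complex_of_real r" for r] by (intro sublinearI p_add) (metis abs_of_nonneg norm_of_real scaleC_of_real)
  moreover have "linear (\<lambda>x. Re (f x))"
    using bounded_linear.linear[OF bounded_linear_Re] f(1) by (simp add: linear_iff)
  moreover have "Re (f x) \<le> p (R x)" for x
    using le[of x] complex_Re_le_cmod[of "f x"] by linarith
  ultimately obtain g where g: "linear g" "\<And>y. g y \<le> p y" "\<And>x. g (R x) = Re (f x)"
    using hahn_banach_real[OF _ R(1)] by blast
  define h where "h y = Complex (g y) (- g (\<i> *\<^sub>C y))" for y
  have h_add: "h (x + y) = h x + h y" for x y
    by (simp add: h_def complex_eq_iff linear_add[OF g(1)] scaleC_add_right)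
  have h_scaleR: "h (r *\<^sub>R x) = r *\<^sub>R h x" for r x
    by (simp add: h_def complex_eq_iff linear_scale[OF g(1)] scaleC_scaleR_commute)
  have h_scale: "h (c *\<^sub>C x) = c * h x" for c x
  proof -
    have "c *\<^sub>C x = Re c *\<^sub>R x + Im c *\<^sub>R (\<i> *\<^sub>C x)"
      using scaleC_add_left[of "complex_of_real (Re c)" "\<i> * complex_of_real (Im c)" x]
        scaleC_scaleC[of \<i> "complex_of_real (Im c)" x]
      by (simp add: complex_eq[symmetric] scaleC_scaleR_commute del: scaleC_scaleC)
    then have "h (c *\<^sub>C x) = Re c *\<^sub>R h x + Im c *\<^sub>R h (\<i> *\<^sub>C x)"
      by (simp add: h_add h_scaleR)
    moreover have "h (\<i> *\<^sub>C x) = \<i> * h x"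
      using scaleC_minus_left[of 1 x]
      by (simp add: h_def complex_eq_iff linear_neg[OF g(1)])
    ultimately show ?thesis by (simp add: complex_eq_iff)
  qed
  have h_le: "cmod (h y) \<le> p y" for y
  proof (cases "h y = 0")
    case True
    then show ?thesis
      using g(2)[of y] by (metis Complex_eq_0 h_def norm_zero)
  next
    case False
    define c where "c = cnj (h y) / complex_of_real (cmod (h y))"
    have c: "cmod c = 1" "c * h y = complex_of_real (cmod (h y))"
      using False complex_norm_square[of "h y"]
      by (auto simp: c_def norm_divide field_simps power2_eq_square)
    have "cmod (h y) = Re (h (c *\<^sub>C y))" by (simp add: h_scale c)
    also have "\<dots> \<le> p (c *\<^sub>C y)" using g(2) by (simp add: h_def)
    also have "\<dots> \<le> p y" using p_scale[of c y] c by simp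
    finally show ?thesis .
  qed
  have "bounded_linear h"
    using h_le p_bound
    by (intro bounded_linear_intro[where K = K]) (auto simp: h_add h_scaleR mult.commute intro: order_trans)
  then obtain H where H: "clop_apply H = h"
    using clop_exists[of h] h_scale by auto
  have "h (R x) = f x" for x
    using g(3)[of x] g(3)[of "\<i> *\<^sub>C x"] by (simp add: h_def R(2) f(2) complex_eq_iff)
  then show thesis using that[of H] h_le by (simp add: H)
qed

text \<open>The superior limit of \<open>cmod (\<phi> n f)\<close>, obtained as the limit
  \<open>p\<close> of the decreasing tail suprema \<open>b\<close>, is a bounded seminorm, non-zero
  at \<open>f0\<close>. A functional dominated by \<open>p\<close> with value \<open>p f0\<close> at
  \<open>f0\<close> is non-zero and vanishes wherever \<open>p\<close> does.\<close>

lemma generalized_limit: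
  fixes \<phi> :: "nat \<Rightarrow> 'a::cbanach \<Rightarrow> complex"
  assumes add: "\<And>n f g. \<phi> n (f + g) = \<phi> n f + \<phi> n g" and scale: "\<And>n c f. \<phi> n (c *\<^sub>C f) = c * \<phi> n f"
    and bound: "\<And>n f. cmod (\<phi> n f) \<le> K * norm f"
    and nontriv: "\<not> (\<lambda>n. \<phi> n f0) \<longlonglongrightarrow> 0"
  obtains h :: "'a dual" where "h \<noteq> 0" "\<And>f. (\<lambda>n. \<phi> n f) \<longlonglongrightarrow> 0 \<Longrightarrow> clop_apply h f = 0"
proof -
  define b where "b N f = (SUP n\<in>{N..}. cmod (\<phi> n f))" for N f
  define p where "p f = lim (\<lambda>N. b N f)" for f
  have bdd: "bdd_above ((\<lambda>n. cmod (\<phi> n f)) ` {N..})" for N f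
    by (rule bdd_aboveI2[OF bound])
  have up: "cmod (\<phi> n f) \<le> b N f" if "N \<le> n" for n N f
    unfolding b_def by (rule cSUP_upper[OF _ bdd]) (use that in auto)
  have least: "b N f \<le> B" if "\<And>n. N \<le> n \<Longrightarrow> cmod (\<phi> n f) \<le> B" for B N f
    unfolding b_def by (rule cSUP_least) (use that in auto)
  have b_nonneg: "0 \<le> b N f" for N f
    using up[of N N f] norm_ge_zero order_trans by blast
  have "decseq (\<lambda>N. b N f)" for f
    by (intro decseq_SucI least up) auto
  then have b_lim: "(\<lambda>N. b N f) \<longlonglongrightarrow> p f" for f
    using decseq_convergent[of "\<lambda>N. b N f" 0] b_nonneg limI unfolding p_def by metis
  have p_add: "p (f + g) \<le> p f + p g" for f g
  proof (rule LIMSEQ_le[OF b_lim tendsto_add[OF b_lim b_lim]])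
    have "b N (f + g) \<le> b N f + b N g" for N
      by (rule least) (metis add norm_triangle_le up add_mono)
    then show "\<exists>N. \<forall>n\<ge>N. b n (f + g) \<le> b n f + b n g" by blast
  qed
  have p_scale: "p (c *\<^sub>C f) \<le> cmod c * p f" for c f
  proof (rule LIMSEQ_le[OF b_lim tendsto_mult_left[OF b_lim]])
    have "b N (c *\<^sub>C f) \<le> cmod c * b N f" for N
      by (rule least) (simp add: scale norm_mult mult_left_mono up)
    then show "\<exists>N. \<forall>n\<ge>N. b n (c *\<^sub>C f) \<le> cmod c * b n f" by blast
  qed
  have p_nonneg: "0 \<le> p f" for f
    by (rule LIMSEQ_le_const[OF b_lim]) (use b_nonneg in blast)
  have p_bound: "p f \<le> K * norm f" for f
    by (rule LIMSEQ_le_const2[OF b_lim]) (use least bound in blast)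
  have "p f0 \<noteq> 0"
  proof
    assume "p f0 = 0"
    then have "(\<lambda>n. b n f0) \<longlonglongrightarrow> 0" using b_lim by metis
    then have "(\<lambda>n. \<phi> n f0) \<longlonglongrightarrow> 0"
      by (rule Lim_null_comparison[rotated]) (simp add: up)
    with nontriv show False by blast
  qed
  have le: "cmod (c * complex_of_real (p f0)) \<le> p (c *\<^sub>C f0)" for c
  proof (cases "c = 0")
    case False
    then have "p f0 \<le> cmod (inverse c) * p (c *\<^sub>C f0)"
      using p_scale[of "inverse c" "c *\<^sub>C f0"] by simp
    then have "cmod c * p f0 \<le> cmod c * (cmod (inverse c) * p (c *\<^sub>C f0))"
      by (rule mult_left_mono) simp
    also have "\<dots> = p (c *\<^sub>C f0)"
      using False by (simp add: norm_inverse)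
    finally show ?thesis using p_nonneg[of f0] by (simp add: norm_mult)
  qed (use p_nonneg in simp)
  obtain h :: "'a dual" where h: "\<And>f. cmod (clop_apply h f) \<le> p f"
      "\<And>c. clop_apply h (c *\<^sub>C f0) = c * complex_of_real (p f0)"
  proof (rule hahn_banach_complex[OF p_add p_scale p_bound _ _ _ _ le])
    show "linear (\<lambda>c. c *\<^sub>C f0)"
      by (rule linearI) (auto simp: scaleC_add_left scaleR_conv_of_real scaleC_scaleC[symmetric]
          simp del: scaleC_scaleC)
    show "linear (\<lambda>c. c * complex_of_real (p f0))"
      by (rule linearI) (auto simp: algebra_simps)
  qed (auto simp: algebra_simps)
  show thesis
  proof (rule that)
    show "h \<noteq> 0" using h(2)[of 1] \<open>p f0 \<noteq> 0\<close> by auto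
    fix f assume lim: "(\<lambda>n. \<phi> n f) \<longlonglongrightarrow> 0"
    have "p f \<le> e" if "0 < e" for e
    proof (rule LIMSEQ_le_const2[OF b_lim])
      obtain N where "\<forall>n\<ge>N. cmod (\<phi> n f) < e" using LIMSEQ_D[OF lim \<open>0 < e\<close>] by auto
      then have "b n f \<le> e" if "n \<ge> N" for n
        using that by (intro least) (simp add: less_imp_le)
      then show "\<exists>N. \<forall>n\<ge>N. b n f \<le> e" by blast
    qed
    then have "p f \<le> 0" by (rule field_le_epsilon[of _ 0, simplified])
    with h(1)[of f] have "cmod (clop_apply h f) \<le> 0" by linarith
    then show "clop_apply h f = 0" by simp
  qed
qed


section \<open>The pairing of the two sequence spaces\<close>

abbreviation pair :: "l1 \<Rightarrow> linf \<Rightarrow> complex"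
  where "pair x f \<equiv> clop_apply (linf_functional f) x"

lemma cmod_pair_le: "cmod (pair x f) \<le> norm x * norm f"
  using norm_clop_le[of "linf_functional f" x] by (simp add: norm_linf_functional mult.commute)

lemma pair_add_right: "pair x (f + g) = pair x f + pair x g"
  unfolding linf_functional_apply
  by (subst suminf_add[OF summable_norm_cancel[OF summable_pairing(1)] summable_norm_cancel[OF summable_pairing(1)]])
    (simp add: distrib_left)

lemma pair_scaleC_right: "pair x (c *\<^sub>C f) = c * pair x f"
  unfolding linf_functional_apply
  by (subst suminf_mult[OF summable_norm_cancel[OF summable_pairing(1)], symmetric])
    (simp add: mult.left_commute)

lemma linear_pair_right: "linear (pair x)"
  using pair_scaleC_right[where c = "complex_of_real r" and x = x for r]
  by (intro linearI pair_add_right) (simp add: scaleR_conv_of_real)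

lemma linear_pair_left: "linear (\<lambda>x. pair x f)"
  by (rule bounded_linear.linear[OF bounded_linear_clop_apply])

lemma pair_eqI: "(\<And>x. pair x f = pair x g) \<Longrightarrow> f = g"
  by (rule injD[OF bij_is_inj[OF bij_linf_functional]], rule clop_eqI)

section \<open>Range of an adjoint, and Schur's theorem\<close>

text \<open>Sending \<open>R x\<close> to \<open>pair x f\<close> is a functional on the range of
  \<open>R\<close> bounded by \<open>norm f / c\<close>. A Hahn-Banach extension with the same bound
  is represented by some \<open>g\<close>, and the adjoint relation turns this into
  \<open>A g = f\<close>. Plain functions \<open>R\<close> and \<open>A\<close> cover both powers
  and \<open>S - \<mu>\<close>.\<close>

lemma bounded_below_imp_adjoint_onto:
  fixes R :: "l1 \<Rightarrow> l1" and A :: "linf \<Rightarrow> linf"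
  assumes R: "linear R" "\<And>c x. R (c *\<^sub>C x) = c *\<^sub>C R x"
    and adj: "\<And>x g. pair x (A g) = pair (R x) g"
    and c: "0 < c" "\<And>x. c * norm x \<le> norm (R x)"
  obtains g where "A g = f" "c * norm g \<le> norm f"
proof -
  define p where "p y = (norm f / c) * norm y" for y :: l1
  have pos: "0 \<le> norm f / c" using c by simp
  have le: "cmod (pair x f) \<le> p (R x)" for x
  proof -
    have "c * cmod (pair x f) \<le> (c * norm x) * norm f"
      using mult_left_mono[OF cmod_pair_le[where x = x and f = f], of c] c by (simp add: mult.assoc)
    also have "\<dots> \<le> norm (R x) * norm f" by (rule mult_right_mono[OF c(2)]) simp
    finally show ?thesis using c(1) by (simp add: p_def field_simps)
  qed
  have p_add: "p (x + y) \<le> p x + p y" for x y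
    unfolding p_def distrib_left[symmetric] by (rule mult_left_mono[OF norm_triangle_ineq pos])
  obtain h :: "l1 dual" where h: "\<And>y. cmod (clop_apply h y) \<le> p y" "\<And>x. clop_apply h (R x) = pair x f"
    by (rule hahn_banach_complex[OF p_add _ _ R linear_pair_left _ le, where K = "norm f / c"])
      (auto simp: p_def clop_scaleC mult.left_commute)
  obtain g where g: "h = linf_functional g"
    using bij_is_surj[OF bij_linf_functional] by (metis surjD)
  have "norm g \<le> norm f / c"
    using norm_clop_bound[OF pos, of h] h(1) by (simp add: p_def g norm_linf_functional)
  then have "c * norm g \<le> norm f" using c(1) by (simp add: field_simps)
  moreover have "A g = f"
    by (rule pair_eqI) (use h(2) in \<open>simp add: adj g\<close>)
  ultimately show thesis using that by blast
qed

lemma apply_Bcontfun_nat: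
  fixes u :: "nat \<Rightarrow> complex"
  assumes "\<And>k. cmod (u k) \<le> B"
  shows "apply_bcontfun (Bcontfun u) = u"
  using assms by (intro Bcontfun_inverse bcontfun_normI[of _ B]) auto

text \<open>Schur's theorem for \<^typ>\<open>l1\<close>, by a gliding hump: a weak null sequence of unit vectors would have
  almost all of its mass on successive disjoint blocks, and the signs on these blocks define a bounded
  sequence that does not pair to zero.\<close>

lemma unit_sequence_not_weakly_null:
  fixes x :: "nat \<Rightarrow> l1"
  assumes unit: "\<And>n. norm (x n) = 1"
  obtains f where "\<not> (\<lambda>n. pair (x n) f) \<longlonglongrightarrow> 0"
proof (rule ccontr)
  assume "\<not> thesis"
  then have null: "(\<lambda>n. pair (x n) f) \<longlonglongrightarrow> 0" for f using that by blast
  have coord: "(\<lambda>n. l1_nth (x n) k) \<longlonglongrightarrow> 0" for k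
  proof -
    have "pair y (Bcontfun (\<lambda>n. if n = k then 1 else 0)) = l1_nth y k" for y
      unfolding linf_functional_apply
      by (subst apply_Bcontfun_nat[of _ 1], simp)
        (subst suminf_finite[of "{k}"], auto)
    then show ?thesis using null[of "Bcontfun (\<lambda>n. if n = k then 1 else 0)"] by simp
  qed
  \<comment> \<open>At some later index less than \<open>1 / 8\<close> of the mass sits before
    \<open>N\<close>; an end \<open>M\<close> with more than \<open>7 / 8\<close> before it leaves
    more than \<open>3 / 4\<close> in between.\<close>
  have hump: "\<exists>n>m. \<exists>M\<ge>N. 3 / 4 < (\<Sum>k\<in>{N..<M}. cmod (l1_nth (x n) k))" for m N
  proof -
    have "(\<lambda>n. \<Sum>k<N. cmod (l1_nth (x n) k)) \<longlonglongrightarrow> (\<Sum>k<N. 0)"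
      by (intro tendsto_sum tendsto_norm_zero coord)
    then have "\<forall>\<^sub>F n in sequentially. (\<Sum>k<N. cmod (l1_nth (x n) k)) < 1 / 8"
      by (intro order_tendstoD(2)) auto
    then have "\<forall>\<^sub>F n in sequentially. m < n \<and> (\<Sum>k<N. cmod (l1_nth (x n) k)) < 1 / 8"
      by (intro eventually_conj eventually_gt_at_top)
    then obtain n where n: "m < n" "(\<Sum>k<N. cmod (l1_nth (x n) k)) < 1 / 8"
      by (auto simp: eventually_sequentially)
    have "(\<lambda>M. \<Sum>k<M. cmod (l1_nth (x n) k)) \<longlonglongrightarrow> 1"
      using summable_LIMSEQ[OF summable_norm_l1[of "x n"]] unit[of n] by (simp add: norm_l1_def)
    then have "\<forall>\<^sub>F M in sequentially. 7 / 8 < (\<Sum>k<M. cmod (l1_nth (x n) k))"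
      by (intro order_tendstoD(1)) auto
    then have "\<forall>\<^sub>F M in sequentially. N \<le> M \<and> 7 / 8 < (\<Sum>k<M. cmod (l1_nth (x n) k))"
      by (intro eventually_conj eventually_ge_at_top)
    then obtain M where M: "N \<le> M" "7 / 8 < (\<Sum>k<M. cmod (l1_nth (x n) k))"
      by (auto simp: eventually_sequentially)
    have "(\<Sum>k<M. cmod (l1_nth (x n) k))
        = (\<Sum>k<N. cmod (l1_nth (x n) k)) + (\<Sum>k\<in>{N..<M}. cmod (l1_nth (x n) k))"
      using sum.atLeastLessThan_concat[of 0 N M "\<lambda>k. cmod (l1_nth (x n) k)"] M(1)
      by (simp add: lessThan_atLeast0)
    then show ?thesis using n M by (intro exI[of _ n] exI[of _ M] conjI) auto
  qed
  obtain s :: "nat \<Rightarrow> nat \<times> nat" where s: "\<And>j. fst (s j) < fst (s (Suc j))"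
      "\<And>j. snd (s j) \<le> snd (s (Suc j))"
      "\<And>j. 3 / 4 < (\<Sum>k\<in>{snd (s j)..<snd (s (Suc j))}. cmod (l1_nth (x (fst (s (Suc j)))) k))"
  proof -
    have "\<forall>t. \<exists>u. fst t < fst u \<and> snd t \<le> snd u \<and>
        3 / 4 < (\<Sum>k\<in>{snd t..<snd u}. cmod (l1_nth (x (fst u)) k))"
    proof
      fix t :: "nat \<times> nat"
      obtain n M where "fst t < n" "snd t \<le> M" "3 / 4 < (\<Sum>k\<in>{snd t..<M}. cmod (l1_nth (x n) k))"
        using hump[of "fst t" "snd t"] by blast
      then show "\<exists>u. fst t < fst u \<and> snd t \<le> snd u \<and>
          3 / 4 < (\<Sum>k\<in>{snd t..<snd u}. cmod (l1_nth (x (fst u)) k))"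
        by (intro exI[of _ "(n, M)"]) simp
    qed
    then obtain F where F: "\<forall>t. fst t < fst (F t) \<and> snd t \<le> snd (F t) \<and>
        3 / 4 < (\<Sum>k\<in>{snd t..<snd (F t)}. cmod (l1_nth (x (fst (F t))) k))"
      by (rule choice[THEN exE])
    define s where "s j = (F ^^ j) (0, 0)" for j
    have s_Suc: "s (Suc j) = F (s j)" for j by (simp add: s_def)
    show thesis
      using F[rule_format, of "s j" for j] by (intro that[of s]) (auto simp only: s_Suc)
  qed
  \<comment> \<open>Shifted by one: block \<open>j\<close> runs between the ends stored in
    \<open>s j\<close> and \<open>s (Suc j)\<close>, while its vector is the one stored in
    \<open>s (Suc j)\<close>.\<close>
  define n where "n j = fst (s (Suc j))" for j
  define M where "M j = snd (s j)" for j
  define blk where "blk k = (LEAST j. k < M (Suc j))" for k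
  define u where "u k = cnj (sgn (l1_nth (x (n (blk k))) k))" for k
  have "mono M" unfolding M_def by (rule incseq_SucI) (rule s(2))
  have blk: "blk k = j" if "k \<in> {M j..<M (Suc j)}" for k j
    unfolding blk_def
  proof (rule Least_equality)
    fix i assume "k < M (Suc i)"
    show "j \<le> i"
    proof (rule ccontr)
      assume "\<not> j \<le> i"
      then have "M (Suc i) \<le> M j" using \<open>mono M\<close> by (simp add: monoD)
      then show False using \<open>k < M (Suc i)\<close> that by simp
    qed
  qed (use that in simp)
  have u_le: "cmod (u k) \<le> 1" for k by (simp add: u_def norm_sgn)
  define f where "f = Bcontfun u"
  have f: "apply_bcontfun f = u" unfolding f_def by (rule apply_Bcontfun_nat[OF u_le])
  have big: "1 / 2 \<le> cmod (pair (x (n j)) f)" for j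
  proof -
    let ?a = "\<lambda>k. l1_nth (x (n j)) k"
    let ?B = "{M j..<M (Suc j)}"
    \<comment> \<open>Worst case: full gain on the block and full loss outside. The total is twice
      the block mass minus the unit norm, which exceeds \<open>2 * 3 / 4 - 1\<close>.\<close>
    let ?g = "\<lambda>k. (if k \<in> ?B then 2 * cmod (?a k) else 0) - cmod (?a k)"
    have g: "?g sums ((\<Sum>k\<in>?B. 2 * cmod (?a k)) - norm (x (n j)))"
      unfolding norm_l1_def
      by (intro sums_diff sums_If_finite_set summable_sums) auto
    have pw: "?g k \<le> Re (?a k * u k)" for k
    proof (cases "k \<in> ?B")
      case True
      then have "?a k * u k = complex_of_real (cmod (?a k))"
        using complex_norm_square[of "?a k"]
        by (cases "?a k = 0") (auto simp: u_def blk sgn_div_norm scaleR_conv_of_real power2_eq_square field_simps)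
      then show ?thesis using True by simp
    next
      case False
      have "cmod (?a k * u k) \<le> cmod (?a k)"
        using mult_left_mono[OF u_le[of k], of "cmod (?a k)"] by (simp add: norm_mult)
      then have "- cmod (?a k) \<le> Re (?a k * u k)" using abs_Re_le_cmod[of "?a k * u k"] by linarith
      moreover have "?g k = - cmod (?a k)" using False by (simp only: if_False diff_0)
      ultimately show ?thesis by (simp only:)
    qed
    have sm: "summable (\<lambda>k. ?a k * u k)"
      using summable_norm_cancel[OF summable_pairing(1)[of "x (n j)" f]] by (simp add: f)
    have "3 / 4 < (\<Sum>k\<in>?B. cmod (?a k))" using s(3)[of j] by (simp add: n_def M_def)
    then have "1 / 2 \<le> (\<Sum>k\<in>?B. 2 * cmod (?a k)) - norm (x (n j))"
      by (simp add: sum_distrib_left[symmetric] unit)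
    also have "\<dots> \<le> Re (pair (x (n j)) f)"
      unfolding linf_functional_apply f
      by (rule sums_le[OF _ g sums_Re[OF summable_sums[OF sm]]]) (rule pw)
    also have "\<dots> \<le> cmod (pair (x (n j)) f)" by (rule complex_Re_le_cmod)
    finally show ?thesis .
  qed
  have "strict_mono n" unfolding n_def by (rule strict_mono_Suc_iff[THEN iffD2]) (simp add: s(1))
  then have "(\<lambda>j. pair (x (n j)) f) \<longlonglongrightarrow> 0"
    using LIMSEQ_subseq_LIMSEQ[OF null, of n f] by (simp add: o_def)
  then have "(\<lambda>j. cmod (pair (x (n j)) f)) \<longlonglongrightarrow> 0" by (rule tendsto_norm_zero)
  from LIMSEQ_le_const[OF this, of "1 / 2"] big show False by auto
qed

text \<open>Unit vectors \<open>x n\<close> with \<open>R (x n)\<close> tending to zero are not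
  weakly null by Schur's theorem, so a generalized limit of the functionals
  \<open>pair (x n)\<close> is non-zero. On \<open>A g\<close> these functionals take the values
  \<open>pair (R (x n)) g\<close>, which tend to zero.\<close>

lemma not_bounded_below_imp_adjoint_range_annihilated:
  fixes R :: "l1 \<Rightarrow> l1" and A :: "linf \<Rightarrow> linf"
  assumes R: "linear R" and adj: "\<And>x g. pair x (A g) = pair (R x) g"
    and nbb: "\<And>c. 0 < c \<Longrightarrow> \<exists>x. norm (R x) < c * norm x"
  obtains h :: "linf dual" where "h \<noteq> 0" "\<And>g. clop_apply h (A g) = 0"
proof -
  have "\<exists>x. norm x = 1 \<and> norm (R x) < inverse (real (Suc n))" for n
  proof -
    obtain y where y: "norm (R y) < inverse (real (Suc n)) * norm y"
      using nbb[of "inverse (real (Suc n))"] by auto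
    then have "norm y > 0" using linear_0[OF R] by (cases "y = 0") auto
    then show ?thesis
      using y by (intro exI[of _ "inverse (norm y) *\<^sub>R y"]) (auto simp: linear_scale[OF R] field_simps)
  qed
  then obtain x where x: "\<And>n. norm (x n) = 1" "\<And>n. norm (R (x n)) < inverse (real (Suc n))"
    by metis
  have lim: "(\<lambda>n. R (x n)) \<longlonglongrightarrow> 0"
    by (rule Lim_null_comparison[OF _ LIMSEQ_inverse_real_of_nat]) (use x(2) in \<open>simp add: less_imp_le\<close>)
  obtain f where f: "\<not> (\<lambda>n. pair (x n) f) \<longlonglongrightarrow> 0"
    using unit_sequence_not_weakly_null[of x] x(1) by blast
  obtain h :: "linf dual" where h: "h \<noteq> 0" "\<And>f. (\<lambda>n. pair (x n) f) \<longlonglongrightarrow> 0 \<Longrightarrow> clop_apply h f = 0"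
    by (rule generalized_limit[of "\<lambda>n. pair (x n)" 1, OF pair_add_right pair_scaleC_right _ f])
      (use cmod_pair_le x(1) in \<open>metis\<close>, blast)
  have "(\<lambda>n. pair (R (x n)) g) \<longlonglongrightarrow> pair 0 g" for g
    by (rule bounded_linear.tendsto[OF bounded_linear_clop_apply lim])
  then have "clop_apply h (A g) = 0" for g
    by (intro h(2)) (simp add: adj linear_0[OF linear_pair_left])
  then show thesis using h(1) that by blast
qed

section \<open>Expanding operators\<close>

lemma clop_add_right: "clop_apply T (x + y) = clop_apply T x + clop_apply T y"
  by (rule linear_add[OF bounded_linear.linear[OF bounded_linear_clop_apply]])

lemma clop_diff_right: "clop_apply T (x - y) = clop_apply T x - clop_apply T y"
  by (rule linear_diff[OF bounded_linear.linear[OF bounded_linear_clop_apply]])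

lemma clop_zero_right [simp]: "clop_apply T 0 = 0"
  by (rule linear_0[OF bounded_linear.linear[OF bounded_linear_clop_apply]])

lemma clop_sum_right: "clop_apply T (\<Sum>i\<in>I. x i) = (\<Sum>i\<in>I. clop_apply T (x i))"
  by (rule linear_sum[OF bounded_linear.linear[OF bounded_linear_clop_apply]])

lemma scaleC_sum_right: "c *\<^sub>C (\<Sum>i\<in>I. x i) = (\<Sum>i\<in>I. c *\<^sub>C (x i :: 'a::cbanach))"
  by (rule linear_sum[OF bounded_linear.linear[OF bounded_linear_scaleC]])

lemma scaleC_sum_left: "(\<Sum>i\<in>I. c i) *\<^sub>C (x :: 'a::cbanach) = (\<Sum>i\<in>I. c i *\<^sub>C x)"
  by (induction I rule: infinite_finite_induct) (simp_all add: scaleC_add_left)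

lemma clop_power_add: "clop_apply (T ^\<^sub>B (m + n)) x = clop_apply (T ^\<^sub>B m) (clop_apply (T ^\<^sub>B n) x)"
  by (induction m) simp_all

lemma linear_clop_minus_scaleC: "linear (\<lambda>x. clop_apply T x - c *\<^sub>C x)"
  by (rule linearI) (simp_all add: clop_add_right scaleC_add_right algebra_simps scaleC_scaleR_commute
      linear_scale[OF bounded_linear.linear[OF bounded_linear_clop_apply]])

section \<open>Quotients of powers and a Cauchy estimate over roots of unity\<close>

text \<open>The operator form of the polynomial quotient of \<open>S^n - z^n\<close> by
  \<open>S - z\<close>.\<close>

definition power_quotient :: "('a::cbanach \<Rightarrow>\<^sub>B 'a) \<Rightarrow> nat \<Rightarrow> complex \<Rightarrow> 'a \<Rightarrow> 'a"
  where "power_quotient S n z x = (\<Sum>k<n. z ^ k *\<^sub>C clop_apply (S ^\<^sub>B (n - Suc k)) x)"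

lemma power_quotient:
  "clop_apply S (power_quotient S n z x) - z *\<^sub>C power_quotient S n z x
    = clop_apply (S ^\<^sub>B n) x - z ^ n *\<^sub>C x"
proof -
  let ?g = "\<lambda>k. z ^ k *\<^sub>C clop_apply (S ^\<^sub>B (n - k)) x"
  have "clop_apply S (power_quotient S n z x) - z *\<^sub>C power_quotient S n z x = (\<Sum>k<n. ?g k - ?g (Suc k))"
    unfolding power_quotient_def clop_sum_right scaleC_sum_right sum_subtractf[symmetric]
  proof (rule sum.cong)
    fix k assume "k \<in> {..<n}"
    then have "S ^\<^sub>B (n - k) = S o\<^sub>B (S ^\<^sub>B (n - Suc k))"
      by (simp add: Suc_diff_Suc flip: clop_power.simps(2))
    then show "clop_apply S (z ^ k *\<^sub>C clop_apply (S ^\<^sub>B (n - Suc k)) x)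
        - z *\<^sub>C z ^ k *\<^sub>C clop_apply (S ^\<^sub>B (n - Suc k)) x = ?g k - ?g (Suc k)"
      by (simp add: clop_scaleC)
  qed simp
  also have "\<dots> = ?g 0 - ?g n" by (rule sum_lessThan_telescope')
  finally show ?thesis by simp
qed

lemma power_quotient_commute:
  "clop_apply (S ^\<^sub>B m) (power_quotient S n z x) = power_quotient S n z (clop_apply (S ^\<^sub>B m) x)"
  by (simp add: power_quotient_def clop_sum_right clop_scaleC clop_power_add[symmetric] add.commute)

lemma power_quotient_diff:
  "power_quotient S n z (x - c *\<^sub>C y) = power_quotient S n z x - c *\<^sub>C power_quotient S n z y"
  by (simp add: power_quotient_def clop_diff_right clop_scaleC scaleC_diff_right sum_subtractf
      scaleC_sum_right mult.commute)

text \<open>The powers of \<open>w ^ Suc k\<close> sum to zero unless \<open>n\<close> divides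
  \<open>Suc k\<close>, and below \<open>2 * n\<close> the only positive multiple is
  \<open>n\<close>. The range of \<open>k\<close> is that of the degrees in a product of two
  polynomials of degree \<open>n - 1\<close>.\<close>

lemma root_of_unity_average:
  fixes n k :: nat and r :: real
  defines "w \<equiv> exp (2 * of_real pi * \<i> / of_nat n)"
  assumes k: "0 < n" "k < 2 * n - 1"
  shows "(\<Sum>j<n. w ^ j * (complex_of_real r * w ^ j) ^ k)
    = (if k = n - 1 then of_nat n * complex_of_real r ^ k else 0)"
proof -
  have wn: "w ^ n = 1"
    using complex_root_unity[of n 1] k(1) by (simp add: w_def)
  have "(\<Sum>j<n. w ^ j * (complex_of_real r * w ^ j) ^ k) = complex_of_real r ^ k * (\<Sum>j<n. (w ^ Suc k) ^ j)"
    unfolding sum_distrib_left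
  proof (rule sum.cong[OF refl])
    fix j
    have "(w ^ Suc k) ^ j = (w ^ j) ^ Suc k" by (simp only: power_mult[symmetric] mult.commute)
    then show "w ^ j * (complex_of_real r * w ^ j) ^ k = complex_of_real r ^ k * (w ^ Suc k) ^ j"
      by (simp only: power_mult_distrib power_Suc mult_ac)
  qed
  also have "\<dots> = (if k = n - 1 then of_nat n * complex_of_real r ^ k else 0)"
  proof (cases "k = n - 1")
    case True
    then have "Suc k = n" using k(1) by simp
    then show ?thesis using True by (simp add: wn del: power_Suc)
  next
    case False
    have "w ^ Suc k = exp (2 * of_real pi * \<i> * of_nat (Suc k) / of_nat n)"
      unfolding w_def exp_of_nat_mult[symmetric] by (simp add: field_simps)
    moreover have "\<not> n dvd Suc k"
    proof
      assume "n dvd Suc k"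
      then obtain t where t: "Suc k = n * t" by blast
      have "n * t < n * 2" unfolding t[symmetric] using k by linarith
      then have "t < 2" by simp
      moreover have "t \<noteq> 0" using t by (intro notI) simp
      ultimately have "t = 1" by simp
      then show False using t False by simp
    qed
    ultimately have "w ^ Suc k \<noteq> 1" using complex_root_unity_eq_1[of n "Suc k"] k(1) by simp
    moreover have "(w ^ Suc k) ^ n = (w ^ n) ^ Suc k" by (metis power_mult mult.commute)
    then have "(w ^ Suc k) ^ n = 1" by (simp only: wn power_one)
    ultimately have "(\<Sum>j<n. (w ^ Suc k) ^ j) = 0" by (subst geometric_sum) simp_all
    then show ?thesis using False by simp
  qed
  finally show ?thesis .
qed

text \<open>With \<open>P\<^sub>z = power_quotient S n z\<close>, the coefficient of \<open>z ^ (n - 1)\<close> in \<open>P\<^sub>z (P\<^sub>z x)\<close> is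
  \<open>n *\<^sub>R S ^ (n - 1) x\<close>. The factor \<open>n\<close> is what makes the resulting Cauchy estimate stronger than the
  one for \<open>P\<^sub>z x\<close>.\<close>

lemma power_quotient_average:
  fixes S :: "'a::cbanach \<Rightarrow>\<^sub>B 'a" and n :: nat
  defines "w \<equiv> exp (2 * of_real pi * \<i> / of_nat n)"
  assumes n: "0 < n"
  shows "(\<Sum>j<n. w ^ j *\<^sub>C power_quotient S n (complex_of_real r * w ^ j)
      (power_quotient S n (complex_of_real r * w ^ j) x))
    = (real n * real n * r ^ (n - 1)) *\<^sub>R clop_apply (S ^\<^sub>B (n - 1)) x" (is "?L = _")
proof -
  let ?v = "\<lambda>k l. clop_apply (S ^\<^sub>B (n - Suc k)) (clop_apply (S ^\<^sub>B (n - Suc l)) x)"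
  have "?L = (\<Sum>j<n. \<Sum>k<n. \<Sum>l<n. (w ^ j * (complex_of_real r * w ^ j) ^ (k + l)) *\<^sub>C ?v k l)"
    by (simp add: power_quotient_def clop_sum_right clop_scaleC scaleC_sum_right power_add mult.assoc)
  also have "\<dots> = (\<Sum>k<n. \<Sum>l<n. (\<Sum>j<n. w ^ j * (complex_of_real r * w ^ j) ^ (k + l)) *\<^sub>C ?v k l)"
    unfolding scaleC_sum_left
    by (subst sum.swap, rule sum.cong[OF refl], subst sum.swap, rule refl)
  \<comment> \<open>Each \<open>k < n\<close> has exactly one partner \<open>l\<close> with
    \<open>k + l = n - 1\<close>. These \<open>n\<close> surviving pairs give the second factor
    \<open>n\<close>; the first comes from the sum over the roots.\<close>
  also have "\<dots> = (\<Sum>k<n. \<Sum>l<n. if l = n - Suc k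
      then (of_nat n * complex_of_real r ^ (n - 1)) *\<^sub>C clop_apply (S ^\<^sub>B (n - 1)) x else 0)"
  proof (intro sum.cong refl)
    fix k l assume kl: "k \<in> {..<n}" "l \<in> {..<n}"
    then have "(k + l = n - 1) = (l = n - Suc k)" "k + l < 2 * n - 1" by auto
    moreover have "?v k l = clop_apply (S ^\<^sub>B (n - 1)) x" if "l = n - Suc k"
    proof -
      have "(n - Suc k) + (n - Suc l) = n - 1" using kl that by auto
      then show ?thesis by (simp only: clop_power_add[symmetric])
    qed
    ultimately show "(\<Sum>j<n. w ^ j * (complex_of_real r * w ^ j) ^ (k + l)) *\<^sub>C ?v k l = (if l = n - Suc k
      then (of_nat n * complex_of_real r ^ (n - 1)) *\<^sub>C clop_apply (S ^\<^sub>B (n - 1)) x else 0)"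
      unfolding w_def by (subst root_of_unity_average[OF n]) auto
  qed
  also have "\<dots> = (\<Sum>k<n. (of_nat n * complex_of_real r ^ (n - 1)) *\<^sub>C clop_apply (S ^\<^sub>B (n - 1)) x)"
    by (intro sum.cong refl) (simp add: sum.delta)
  also have "\<dots> = (of_nat n * (of_nat n * complex_of_real r ^ (n - 1))) *\<^sub>C clop_apply (S ^\<^sub>B (n - 1)) x"
    by (simp flip: scaleC_sum_left)
  also have "\<dots> = complex_of_real (real n * real n * r ^ (n - 1)) *\<^sub>C clop_apply (S ^\<^sub>B (n - 1)) x"
    by (simp add: mult.assoc)
  finally show ?thesis by (simp only: scaleC_of_real)
qed

text \<open>For every sample point \<open>z\<close> the lower bound for \<open>S - z\<close>
  controls the quotient \<open>P\<close> by \<open>S^n - r^n\<close>. Using this twice bounds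
  \<open>P (P x)\<close> by \<open>(S^n - r^n)^2 x\<close>, whose expansion has three terms;
  averaging over \<open>z\<close> isolates \<open>S^(n-1) x\<close>.\<close>

lemma bounded_below_on_disc_three_term:
  fixes S :: "'a::cbanach \<Rightarrow>\<^sub>B 'a"
  assumes c: "0 < c" "\<And>z x. cmod z \<le> 1 \<Longrightarrow> c * norm x \<le> norm (clop_apply S x - z *\<^sub>C x)"
    and n: "0 < n" and r: "0 \<le> r" "r \<le> 1"
  shows "c\<^sup>2 * (real n * r ^ (n - 1) * norm (clop_apply (S ^\<^sub>B (n - 1)) x))
    \<le> norm (clop_apply (S ^\<^sub>B (2 * n)) x) + 2 * r ^ n * norm (clop_apply (S ^\<^sub>B n) x) + (r ^ n)\<^sup>2 * norm x"
    (is "_ \<le> ?B")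
proof -
  define w where "w = exp (2 * complex_of_real pi * \<i> / of_nat n)"
  have wn: "w ^ n = 1" and cw: "cmod w = 1"
    using complex_root_unity[of n 1] n by (auto simp: w_def norm_exp)
  define z where "z j = complex_of_real r * w ^ j" for j
  have cz: "cmod (z j) \<le> 1" for j using r by (simp add: z_def norm_mult norm_power cw)
  \<comment> \<open>All sample points share one \<open>n\<close>-th power, so the right-hand side of
    the estimate does not depend on \<open>j\<close>.\<close>
  have zn: "z j ^ n = complex_of_real (r ^ n)" for j
    by (simp add: z_def power_mult_distrib power_mult[symmetric] mult.commute[of j])
      (simp add: power_mult wn)
  let ?P = "\<lambda>j. power_quotient S n (z j)"
  have P: "c * norm (?P j y) \<le> norm (clop_apply (S ^\<^sub>B n) y - complex_of_real (r ^ n) *\<^sub>C y)" for j y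
    using c(2)[OF cz, of "?P j y" j] by (simp only: power_quotient zn)
  have bound: "c\<^sup>2 * norm (?P j (?P j x)) \<le> ?B" for j
  proof -
    let ?s = "complex_of_real (r ^ n)"
    have "c\<^sup>2 * norm (?P j (?P j x)) \<le> c * norm (clop_apply (S ^\<^sub>B n) (?P j x) - ?s *\<^sub>C ?P j x)"
      using mult_left_mono[OF P[of j "?P j x"], of c] c(1) by (simp add: power2_eq_square mult.assoc)
    also have "\<dots> = c * norm (?P j (clop_apply (S ^\<^sub>B n) x - ?s *\<^sub>C x))"
      by (simp only: power_quotient_commute power_quotient_diff)
    also have "\<dots> \<le> norm (clop_apply (S ^\<^sub>B n) (clop_apply (S ^\<^sub>B n) x - ?s *\<^sub>C x)
        - ?s *\<^sub>C (clop_apply (S ^\<^sub>B n) x - ?s *\<^sub>C x))"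
      by (rule P)
    also have "\<dots> = norm (clop_apply (S ^\<^sub>B (2 * n)) x
        - ((2 * r ^ n) *\<^sub>R clop_apply (S ^\<^sub>B n) x - (r ^ n)\<^sup>2 *\<^sub>R x))"
    proof -
      have "(2 * r ^ n) *\<^sub>R y = r ^ n *\<^sub>R y + r ^ n *\<^sub>R y" for y :: 'a
        by (simp only: mult_2 scaleR_add_left)
      moreover have "clop_apply (S ^\<^sub>B (2 * n)) x = clop_apply (S ^\<^sub>B n) (clop_apply (S ^\<^sub>B n) x)"
        by (simp only: mult_2 clop_power_add)
      moreover have "clop_apply (S ^\<^sub>B n) (r ^ n *\<^sub>R x) = r ^ n *\<^sub>R clop_apply (S ^\<^sub>B n) x"
        by (rule linear_scale[OF bounded_linear.linear[OF bounded_linear_clop_apply]])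
      ultimately show ?thesis
        by (simp only: scaleC_of_real clop_diff_right scaleR_diff_right power2_eq_square scaleR_scaleR)
          (simp only: algebra_simps)
    qed
    also have "\<dots> \<le> ?B"
      using norm_triangle_ineq4[of "clop_apply (S ^\<^sub>B (2 * n)) x"
          "(2 * r ^ n) *\<^sub>R clop_apply (S ^\<^sub>B n) x - (r ^ n)\<^sup>2 *\<^sub>R x"]
        norm_triangle_ineq4[of "(2 * r ^ n) *\<^sub>R clop_apply (S ^\<^sub>B n) x" "(r ^ n)\<^sup>2 *\<^sub>R x"] r
      by simp
    finally show ?thesis .
  qed
  \<comment> \<open>The average carries \<open>n\<close> twice, but the sum of \<open>n\<close>
    bounds only once; one factor \<open>n\<close> survives on the left.\<close>
  have "c\<^sup>2 * (real n * (real n * r ^ (n - 1) * norm (clop_apply (S ^\<^sub>B (n - 1)) x)))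
      = c\<^sup>2 * norm (\<Sum>j<n. w ^ j *\<^sub>C ?P j (?P j x))"
    unfolding z_def w_def power_quotient_average[OF n] using r by simp
  also have "\<dots> \<le> c\<^sup>2 * (\<Sum>j<n. norm (?P j (?P j x)))"
    using sum_norm_le[of "{..<n}" "\<lambda>j. w ^ j *\<^sub>C ?P j (?P j x)" "\<lambda>j. norm (?P j (?P j x))"]
    by (intro mult_left_mono) (simp_all add: norm_power cw)
  also have "\<dots> \<le> real n * ?B"
    unfolding sum_distrib_left using sum_bounded_above[of "{..<n}", OF bound] by simp
  finally have "real n * (c\<^sup>2 * (real n * r ^ (n - 1) * norm (clop_apply (S ^\<^sub>B (n - 1)) x))) \<le> real n * ?B"
    by (simp add: mult_ac)
  then show ?thesis using n by simp
qed

text \<open>Choosing \<open>s\<close> optimally in \<open>[0, 1]\<close> shows that either \<open>u (k + 2) \<ge> 4 u (k + 1)\<close> or the ratio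
  of consecutive terms grows at least by the factor \<open>16\<close>.\<close>

lemma three_term_ratio_growth:
  fixes u :: "nat \<Rightarrow> real"
  assumes pos: "\<And>k. 0 < u k"
    and three: "\<And>k s. 0 \<le> s \<Longrightarrow> s \<le> 1 \<Longrightarrow> 8 * s * u (Suc k) \<le> u (Suc (Suc k)) + s\<^sup>2 * u k"
    and start: "d * u 0 \<le> u (Suc 0)"
  shows "min 4 (16 ^ k * d) * u k \<le> u (Suc k)"
proof (induction k)
  case 0
  have "min 4 d * u 0 \<le> d * u 0" by (rule mult_right_mono) (use pos[of 0] in auto)
  then show ?case using start by simp
next
  case (Suc k)
  let ?b0 = "u k" and ?b1 = "u (Suc k)" and ?b2 = "u (Suc (Suc k))"
  show ?case
  proof (cases "4 * ?b1 \<le> ?b0")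
    case True
    \<comment> \<open>The maximizer of \<open>8 * s * ?b1 - s^2 * ?b0\<close>, admissible exactly
      when it is at most 1; half of the linear term is left over. In the other case
      \<open>s = 1\<close> is used.\<close>
    define s where "s = 4 * ?b1 / ?b0"
    have s: "0 \<le> s" "s \<le> 1" "s * ?b0 = 4 * ?b1"
      using True pos[of k] pos[of "Suc k"] by (auto simp: s_def)
    have "8 * s * ?b1 \<le> ?b2 + s * (s * ?b0)" using three[OF s(1,2), of k] by (simp add: power2_eq_square mult.assoc)
    then have b2: "4 * s * ?b1 \<le> ?b2" by (simp add: s(3))
    have "min 4 (16 ^ k * d) \<le> ?b1 / ?b0" using Suc pos[of k] by (simp add: pos_le_divide_eq)
    then have "16 * min 4 (16 ^ k * d) \<le> 4 * s" by (simp add: s_def)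
    moreover have "min 4 (16 * v) \<le> 16 * min 4 v" for v :: real by (auto simp: min_def)
    from this[of "16 ^ k * d"] have "min 4 (16 ^ Suc k * d) \<le> 16 * min 4 (16 ^ k * d)"
      by (simp only: power_Suc mult.assoc)
    ultimately have "min 4 (16 ^ Suc k * d) \<le> 4 * s" by (rule order_trans[rotated])
    from mult_right_mono[OF this, of ?b1] b2 pos[of "Suc k"] show ?thesis by linarith
  next
    case False
    then have "4 * ?b1 \<le> ?b2" using three[of 1 k] by simp
    moreover have "min 4 (16 ^ Suc k * d) * ?b1 \<le> 4 * ?b1"
      by (rule mult_right_mono) (use pos[of "Suc k"] in auto)
    ultimately show ?thesis by linarith
  qed
qed

lemma bounded_below_power:
  assumes c: "0 \<le> c" "\<And>x. c * norm x \<le> norm (clop_apply S x)"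
  shows "c ^ n * norm x \<le> norm (clop_apply (S ^\<^sub>B n) x)"
proof (induction n)
  case (Suc n)
  have "c ^ Suc n * norm x \<le> c * norm (clop_apply (S ^\<^sub>B n) x)"
    using mult_left_mono[OF Suc c(1)] by (simp add: mult.assoc)
  also have "\<dots> \<le> norm (clop_apply (S ^\<^sub>B Suc n) x)" using c(2) by simp
  finally show ?case .
qed simp

text \<open>For large \<open>n\<close> the factor \<open>n\<close> in the three-term estimate beats
  \<open>norm S / c^2\<close>, so the norms of \<open>S^(n k) x\<close> satisfy the hypothesis of
  \<open>three_term_ratio_growth\<close>. Their first ratio is at least \<open>d = c^n\<close>,
  hence after a number of steps independent of \<open>x\<close> all ratios are at least 4.\<close>

lemma bounded_below_on_disc_imp_expanding_power:
  fixes S :: "'a::cbanach \<Rightarrow>\<^sub>B 'a"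
  assumes c: "0 < c" "\<And>z x. cmod z \<le> 1 \<Longrightarrow> c * norm x \<le> norm (clop_apply S x - z *\<^sub>C x)"
  obtains N where "0 < N" "\<And>x. 2 * norm x \<le> norm (clop_apply (S ^\<^sub>B N) x)"
proof -
  define K where "K = norm S + 1"
  have K: "0 < K" by (simp add: K_def add_nonneg_pos)
  \<comment> \<open>Ten is eight plus two: eight is wanted in the recursion, and two pays for the
    middle term of the three-term estimate.\<close>
  obtain n0 where "10 * K / c\<^sup>2 < real n0" using reals_Archimedean2 by blast
  then have n0: "10 * K < c\<^sup>2 * real n0" using c(1) by (simp add: field_simps)
  define n where "n = Suc n0"
  have "c\<^sup>2 * real n0 \<le> c\<^sup>2 * real n" by (intro mult_left_mono) (auto simp: n_def)
  with n0 have n: "0 < n" "10 * K \<le> c\<^sup>2 * real n" by (auto simp: n_def)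
  have three: "8 * s * norm (clop_apply (S ^\<^sub>B n) x) \<le> norm (clop_apply (S ^\<^sub>B (2 * n)) x) + s\<^sup>2 * norm x"
    if s: "0 \<le> s" "s \<le> 1" for s x
  proof -
    define r where "r = root n s"
    have r: "0 \<le> r" "r \<le> 1" "r ^ n = s" using s n(1) by (auto simp: r_def)
    let ?a = "norm (clop_apply (S ^\<^sub>B (n - 1)) x)" and ?b = "norm (clop_apply (S ^\<^sub>B n) x)"
    have "S ^\<^sub>B n = S o\<^sub>B (S ^\<^sub>B (n - 1))" by (simp add: n_def)
    then have "?b \<le> norm S * ?a" using norm_clop_le[of S] by simp
    also have "\<dots> \<le> K * ?a" by (rule mult_right_mono) (auto simp: K_def)
    finally have b: "?b \<le> K * ?a" .
    \<comment> \<open>Trades the exponent \<open>n - 1\<close> for \<open>n\<close>, as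
      \<open>r\<close> lies in the unit interval; the passage from \<open>S^(n-1)\<close> to
      \<open>S^n\<close> costs the factor \<open>K\<close>.\<close>
    have "s \<le> r ^ (n - 1)" unfolding r(3)[symmetric] by (rule power_decreasing) (use r in auto)
    then have "s * ?b \<le> r ^ (n - 1) * (K * ?a)" using b s(1) by (intro mult_mono) auto
    then have "10 * (s * ?b) \<le> 10 * K * (r ^ (n - 1) * ?a)" by (simp add: mult_ac)
    also have "\<dots> \<le> c\<^sup>2 * real n * (r ^ (n - 1) * ?a)"
      using r(1) by (intro mult_right_mono n(2)) simp
    also have "\<dots> \<le> norm (clop_apply (S ^\<^sub>B (2 * n)) x) + 2 * s * ?b + s\<^sup>2 * norm x"
      using bounded_below_on_disc_three_term[OF c n(1) r(1,2), of x] unfolding r(3) by (simp add: mult_ac)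
    finally show ?thesis by simp
  qed
  define d where "d = c ^ n"
  have d: "0 < d" using c(1) by (simp add: d_def)
  have low: "c ^ m * norm x \<le> norm (clop_apply (S ^\<^sub>B m) x)" for m x
    by (rule bounded_below_power) (use c(1) c(2)[of 0] in auto)
  \<comment> \<open>From step \<open>k0\<close> on every ratio is at least 4. The initial
    \<open>k0\<close> steps may shrink the norm by \<open>d ^ k0\<close>; the next \<open>m\<close>
    steps recover this and gain the factor 2.\<close>
  obtain k0 where k0: "4 / d < 16 ^ k0" using real_arch_pow[of 16 "4 / d"] by auto
  obtain m where m: "2 / d ^ k0 < 4 ^ m" using real_arch_pow[of 4 "2 / d ^ k0"] by auto
  have grow: "4 ^ j * (d ^ k0 * norm x) \<le> norm (clop_apply (S ^\<^sub>B (n * (k0 + j))) x)" if "x \<noteq> 0" for x j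
  proof (induction j)
    case 0
    show ?case using low[of "n * k0" x] by (simp add: d_def power_mult)
  next
    case (Suc j)
    define u where "u k = norm (clop_apply (S ^\<^sub>B (n * k)) x)" for k
    have "min 4 (16 ^ (k0 + j) * d) * u (k0 + j) \<le> u (Suc (k0 + j))"
    proof (rule three_term_ratio_growth)
      show "0 < u k" for k
      proof -
        have "0 < c ^ (n * k) * norm x" using c(1) \<open>x \<noteq> 0\<close> by simp
        then show ?thesis using low[of "n * k" x] unfolding u_def by linarith
      qed
      show "8 * s * u (Suc k) \<le> u (Suc (Suc k)) + s\<^sup>2 * u k" if "0 \<le> s" "s \<le> 1" for k s
        using three[OF that, of "clop_apply (S ^\<^sub>B (n * k)) x"]
        by (simp add: u_def clop_power_add[symmetric] mult_2 add.assoc)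
      show "d * u 0 \<le> u (Suc 0)" using low[of n x] by (simp add: u_def d_def)
    qed
    moreover have "4 \<le> 16 ^ (k0 + j) * d"
    proof -
      have "(4::real) \<le> 16 ^ k0 * d" using k0 d by (simp add: field_simps)
      also have "\<dots> \<le> 16 ^ (k0 + j) * d" using d by (intro mult_right_mono power_increasing) auto
      finally show ?thesis .
    qed
    ultimately have "4 * u (k0 + j) \<le> u (Suc (k0 + j))" by simp
    then show ?case using Suc by (simp add: u_def)
  qed
  have "0 < k0 + m"
  proof (rule ccontr)
    assume "\<not> 0 < k0 + m"
    then show False using m by simp
  qed
  show thesis
  proof (rule that[of "n * (k0 + m)"])
    show "0 < n * (k0 + m)" using n(1) \<open>0 < k0 + m\<close> by simp
    fix x
    show "2 * norm x \<le> norm (clop_apply (S ^\<^sub>B (n * (k0 + m))) x)"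
    proof (cases "x = 0")
      case False
      have "2 \<le> 4 ^ m * d ^ k0" using m d by (simp add: field_simps)
      then have "2 * norm x \<le> 4 ^ m * d ^ k0 * norm x" by (rule mult_right_mono) simp
      then show ?thesis using grow[OF False, of m] by (simp add: mult.assoc)
    qed simp
  qed
qed

section \<open>The index of an operator\<close>

text \<open>Fekete's lemma: the limit is the supremum of the quotients. If \<open>b N / N\<close> is
  close to it, dividing \<open>n\<close> by \<open>N\<close> with remainder gives
  \<open>b n >= q b N + b r\<close>, and the remainder contributes a bounded error, negligible after
  division by \<open>n\<close>.\<close>

lemma superadditive_imp_convergent_quotient:
  fixes b :: "nat \<Rightarrow> real"
  assumes super: "\<And>m n. b m + b n \<le> b (m + n)" and le: "\<And>n. b n \<le> C * real n"
  obtains L where "(\<lambda>n. b n / real n) \<longlonglongrightarrow> L" "\<And>n. 0 < n \<Longrightarrow> b n / real n \<le> L"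
proof -
  define L where "L = (SUP n\<in>{0<..}. b n / real n)"
  have bdd: "bdd_above ((\<lambda>n. b n / real n) ` {0<..})"
    using le by (intro bdd_aboveI2[of _ _ C]) (simp add: pos_divide_le_eq)
  have up: "b n / real n \<le> L" if "0 < n" for n
    unfolding L_def by (rule cSUP_upper[OF _ bdd]) (use that in simp)
  have "(\<lambda>n. b n / real n) \<longlonglongrightarrow> L"
  proof (rule order_tendstoI)
    fix a assume "a < L"
    then obtain N where N: "0 < N" "a < b N / real N"
      unfolding L_def by (subst (asm) less_cSUP_iff[OF _ bdd]) auto
    define \<beta> where "\<beta> = b N / real N"
    define B where "B = Min (b ` {..<N})"
    have bN: "b N = \<beta> * real N" using N(1) by (simp add: \<beta>_def)
    have B: "B \<le> b r" if "r < N" for r unfolding B_def by (rule Min_le) (use that in auto)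
    have mult: "real q * b N + b r \<le> b (q * N + r)" for q r
    proof (induction q)
      case (Suc q)
      have "real (Suc q) * b N + b r = b N + (real q * b N + b r)" by (simp add: algebra_simps)
      also have "\<dots> \<le> b (N + (q * N + r))" using super[of N "q * N + r"] Suc by linarith
      finally show ?case by (simp add: add.assoc)
    qed simp
    have low: "\<beta> - (\<bar>\<beta>\<bar> * real N + \<bar>B\<bar>) / real n \<le> b n / real n" if "0 < n" for n
    proof -
      define q where "q = n div N"
      define r where "r = n mod N"
      have n: "n = q * N + r" "r < N" using N(1) by (auto simp: q_def r_def)
      have "\<beta> * real r \<le> \<bar>\<beta>\<bar> * real N"
        using n(2) by (intro mult_mono) auto
      then have "\<beta> * real n - \<bar>\<beta>\<bar> * real N - \<bar>B\<bar> \<le> real q * b N + b r"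
        using B[OF n(2)] by (simp add: bN n(1) algebra_simps)
      then have "\<beta> * real n - \<bar>\<beta>\<bar> * real N - \<bar>B\<bar> \<le> b n" using mult[of q r] n(1) by simp
      then have "(\<beta> * real n - \<bar>\<beta>\<bar> * real N - \<bar>B\<bar>) / real n \<le> b n / real n"
        by (rule divide_right_mono) simp
      moreover have "(\<beta> * real n - \<bar>\<beta>\<bar> * real N - \<bar>B\<bar>) / real n
          = \<beta> - (\<bar>\<beta>\<bar> * real N + \<bar>B\<bar>) / real n"
        using that by (simp add: diff_divide_distrib add_divide_distrib)
      ultimately show ?thesis by simp
    qed
    have "(\<lambda>n. \<beta> - (\<bar>\<beta>\<bar> * real N + \<bar>B\<bar>) / real n) \<longlonglongrightarrow> \<beta> - 0"
      by (intro tendsto_diff tendsto_const lim_const_over_n)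
    then have "\<forall>\<^sub>F n in sequentially. a < \<beta> - (\<bar>\<beta>\<bar> * real N + \<bar>B\<bar>) / real n"
      using N(2) by (intro order_tendstoD(1)) (auto simp: \<beta>_def)
    then show "\<forall>\<^sub>F n in sequentially. a < b n / real n"
      using eventually_gt_at_top[of 0] by eventually_elim (rule less_le_trans[OF _ low])
  next
    fix a assume "L < a"
    then show "\<forall>\<^sub>F n in sequentially. b n / real n < a"
      by (intro eventually_mono[OF eventually_gt_at_top[of 0]] le_less_trans[OF up])
  qed
  then show thesis using up that by blast
qed

section \<open>Minimum modulus of the powers\<close>

lemma kappa_le:
  fixes R :: "'a::cbanach \<Rightarrow>\<^sub>B 'a"
  shows "\<kappa> R * norm x \<le> norm (clop_apply R x)"
proof (cases "x = 0")
  case False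
  let ?y = "inverse (norm x) *\<^sub>R x"
  have "\<kappa> R \<le> norm (clop_apply R ?y)"
    unfolding kappa_def by (rule cInf_lower) (use False in \<open>auto intro!: bdd_belowI[of _ 0] exI[of _ ?y]\<close>)
  also have "\<dots> = norm (clop_apply R x) / norm x"
    by (simp add: linear_scale[OF bounded_linear.linear[OF bounded_linear_clop_apply]] divide_inverse mult.commute)
  finally show ?thesis using False by (simp add: field_simps)
qed simp

text \<open>The vector \<open>x0\<close> makes the unit sphere non-empty, so that the infimum is not
  taken over the empty set.\<close>

lemma kappa_greatest:
  fixes R :: "'a::cbanach \<Rightarrow>\<^sub>B 'a"
  assumes "(x0 :: 'a) \<noteq> 0" and "\<And>x. norm x = 1 \<Longrightarrow> q \<le> norm (clop_apply R x)"
  shows "q \<le> \<kappa> R"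
  unfolding kappa_def
proof (rule cInf_greatest)
  show "{norm (clop_apply R x) | x. norm x = 1} \<noteq> {}"
    using assms(1) by (auto intro!: exI[of _ "inverse (norm x0) *\<^sub>R x0"])
qed (use assms(2) in auto)

context
  fixes S :: "'a::cbanach \<Rightarrow>\<^sub>B 'a" and x0 :: 'a
  assumes x0: "x0 \<noteq> 0"
begin

lemma kappa_nonneg: "0 \<le> \<kappa> (R :: 'a \<Rightarrow>\<^sub>B 'a)"
  by (rule kappa_greatest[OF x0]) simp

lemma kappa_le_norm: "\<kappa> (R :: 'a \<Rightarrow>\<^sub>B 'a) \<le> norm R"
proof -
  have "\<kappa> R * norm x0 \<le> norm R * norm x0"
    using kappa_le[of R x0] norm_clop_le[of R x0] by linarith
  then show ?thesis using x0 by simp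
qed

lemma kappa_power_add: "\<kappa> (S ^\<^sub>B m) * \<kappa> (S ^\<^sub>B n) \<le> \<kappa> (S ^\<^sub>B (m + n))"
proof (rule kappa_greatest[OF x0])
  fix x :: 'a assume x: "norm x = 1"
  have "\<kappa> (S ^\<^sub>B m) * \<kappa> (S ^\<^sub>B n) \<le> \<kappa> (S ^\<^sub>B m) * norm (clop_apply (S ^\<^sub>B n) x)"
    using kappa_le[of "S ^\<^sub>B n" x] x by (intro mult_left_mono kappa_nonneg) simp
  also have "\<dots> \<le> norm (clop_apply (S ^\<^sub>B (m + n)) x)"
    unfolding clop_power_add by (rule kappa_le)
  finally show "\<kappa> (S ^\<^sub>B m) * \<kappa> (S ^\<^sub>B n) \<le> norm (clop_apply (S ^\<^sub>B (m + n)) x)" .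
qed

lemma kappa_power_Suc_eq_0:
  assumes "\<kappa> S = 0"
  shows "\<kappa> (S ^\<^sub>B Suc n) = 0"
proof -
  define K where "K = norm (S ^\<^sub>B n) + 1"
  have K: "0 < K" by (simp add: K_def add_nonneg_pos)
  have "\<kappa> (S ^\<^sub>B Suc n) / K \<le> \<kappa> S"
  proof (rule kappa_greatest[OF x0])
    fix x :: 'a assume x: "norm x = 1"
    have "\<kappa> (S ^\<^sub>B Suc n) \<le> norm (clop_apply (S ^\<^sub>B (n + 1)) x)"
      using kappa_le[of "S ^\<^sub>B Suc n" x] x by simp
    also have "\<dots> = norm (clop_apply (S ^\<^sub>B n) (clop_apply S x))"
      unfolding clop_power_add by simp
    also have "\<dots> \<le> norm (S ^\<^sub>B n) * norm (clop_apply S x)" by (rule norm_clop_le)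
    also have "\<dots> \<le> K * norm (clop_apply S x)" by (rule mult_right_mono) (auto simp: K_def)
    finally show "\<kappa> (S ^\<^sub>B Suc n) / K \<le> norm (clop_apply S x)" using K by (simp add: field_simps)
  qed
  then have "\<kappa> (S ^\<^sub>B Suc n) \<le> 0" using K assms by (simp add: field_simps)
  then show ?thesis using kappa_nonneg[of "S ^\<^sub>B Suc n"] by linarith
qed

text \<open>Fekete's lemma for the logarithms of \<open>\<kappa> (S ^\<^sub>B n)\<close>, which are
  superadditive because \<open>\<kappa>\<close> is supermultiplicative on powers. The limit also
  dominates every term, so a single power can certify a lower bound for the index.\<close>

lemma i_index_limit:
  "(\<lambda>n. root n (\<kappa> (S ^\<^sub>B n))) \<longlonglongrightarrow> i_index S \<and> (\<forall>n>0. root n (\<kappa> (S ^\<^sub>B n)) \<le> i_index S)"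
proof (cases "\<kappa> S = 0")
  case True
  have zero: "root n (\<kappa> (S ^\<^sub>B n)) = 0" for n
    \<comment> \<open>At \<open>n = 0\<close> the value is \<open>root 0\<close>, which is 0 by
      convention.\<close>
    by (cases n) (simp_all only: root_0 kappa_power_Suc_eq_0[OF True] real_root_zero)
  then show ?thesis
    unfolding i_index_def by simp
next
  case False
  then have k1: "0 < \<kappa> S" using kappa_nonneg[of S] by linarith
  have pos: "0 < \<kappa> (S ^\<^sub>B n)" for n
  proof (induction n)
    case 0
    show ?case by (rule less_le_trans[OF zero_less_one], rule kappa_greatest[OF x0]) simp
  next
    case (Suc n)
    have "S ^\<^sub>B 1 = S" by (rule clop_eqI) simp
    then show ?case using kappa_power_add[of 1 n] mult_pos_pos[OF k1 Suc] by simp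
  qed
  have "norm (S ^\<^sub>B n) \<le> (norm S + 1) ^ n" for n
  proof (induction n)
    case 0
    show ?case by (rule norm_clop_bound) auto
  next
    case (Suc n)
    have "norm (S ^\<^sub>B Suc n) \<le> norm S * norm (S ^\<^sub>B n)" by (simp add: norm_clop_compose)
    also have "\<dots> \<le> (norm S + 1) * (norm S + 1) ^ n" by (rule mult_mono[OF _ Suc]) auto
    finally show ?case by simp
  qed
  then have "\<kappa> (S ^\<^sub>B n) \<le> (norm S + 1) ^ n" for n using kappa_le_norm order_trans by blast
  then have "ln (\<kappa> (S ^\<^sub>B n)) \<le> ln ((norm S + 1) ^ n)" for n
    using pos by (subst ln_le_cancel_iff) (auto simp: add_nonneg_pos)
  moreover have "ln ((norm S + 1) ^ n) = ln (norm S + 1) * real n" for n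
    by (simp add: ln_realpow add_nonneg_pos mult.commute)
  ultimately have le: "ln (\<kappa> (S ^\<^sub>B n)) \<le> ln (norm S + 1) * real n" for n by metis
  have super: "ln (\<kappa> (S ^\<^sub>B m)) + ln (\<kappa> (S ^\<^sub>B n)) \<le> ln (\<kappa> (S ^\<^sub>B (m + n)))" for m n
    unfolding ln_mult_pos[OF pos pos, symmetric] using kappa_power_add pos
    by (subst ln_le_cancel_iff) (auto intro: mult_pos_pos)
  obtain L where L: "(\<lambda>n. ln (\<kappa> (S ^\<^sub>B n)) / real n) \<longlonglongrightarrow> L"
      "\<And>n. 0 < n \<Longrightarrow> ln (\<kappa> (S ^\<^sub>B n)) / real n \<le> L"
    using superadditive_imp_convergent_quotient[OF super le] by blast
  have root: "root n (\<kappa> (S ^\<^sub>B n)) = exp (ln (\<kappa> (S ^\<^sub>B n)) / real n)" if "0 < n" for n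
    unfolding root_powr_inverse[OF that less_imp_le[OF pos]] powr_def using pos[of n] by simp
  have "(\<lambda>n. root n (\<kappa> (S ^\<^sub>B n))) \<longlonglongrightarrow> exp L"
  proof (rule Lim_transform_eventually[OF tendsto_exp[OF L(1)]])
    show "\<forall>\<^sub>F n in sequentially. exp (ln (\<kappa> (S ^\<^sub>B n)) / real n) = root n (\<kappa> (S ^\<^sub>B n))"
      using eventually_gt_at_top[of 0] by eventually_elim (simp add: root)
  qed
  then have "i_index S = exp L" unfolding i_index_def by (rule limI)
  then show ?thesis
    using \<open>(\<lambda>n. root n (\<kappa> (S ^\<^sub>B n))) \<longlonglongrightarrow> exp L\<close> L(2) root by simp
qed

lemma i_index_gt_1I:
  assumes "0 < N" "1 < q" "\<And>x. q * norm x \<le> norm (clop_apply (S ^\<^sub>B N) x)"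
  shows "1 < i_index S"
proof -
  have "q \<le> \<kappa> (S ^\<^sub>B N)" by (rule kappa_greatest[OF x0]) (use assms(3) in \<open>metis mult.right_neutral\<close>)
  then have "1 < root N (\<kappa> (S ^\<^sub>B N))" using assms(1,2) by simp
  moreover have "root N (\<kappa> (S ^\<^sub>B N)) \<le> i_index S" using i_index_limit assms(1) by blast
  ultimately show ?thesis by (rule less_le_trans)
qed

text \<open>With \<open>\<rho>\<close> strictly between 1 and the index, the \<open>n\<close>-th
  power of \<open>\<rho>\<close> is eventually a lower bound.\<close>

lemma i_index_gt_1_imp_kappa_power_at_top:
  assumes "1 < i_index S"
  shows "filterlim (\<lambda>n. \<kappa> (S ^\<^sub>B n)) at_top sequentially"
proof -
  obtain \<rho> where \<rho>: "1 < \<rho>" "\<rho> < i_index S" using dense assms by blast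
  have "\<forall>\<^sub>F n in sequentially. \<rho> < root n (\<kappa> (S ^\<^sub>B n))"
    using i_index_limit \<rho>(2) by (auto intro: order_tendstoD)
  then have "\<forall>\<^sub>F n in sequentially. \<rho> ^ n \<le> \<kappa> (S ^\<^sub>B n)"
    using eventually_gt_at_top[of 0]
  proof eventually_elim
    case (elim n)
    then have "\<rho> ^ n \<le> root n (\<kappa> (S ^\<^sub>B n)) ^ n" using \<rho>(1) by (intro power_mono) auto
    then show ?case using elim kappa_nonneg by simp
  qed
  moreover have "filterlim (\<lambda>n. \<rho> ^ n) at_top sequentially"
    by (rule filterlim_at_infinity_imp_filterlim_at_top[OF filterlim_realpow_sequentially_gt1])
      (use \<rho>(1) in auto)
  ultimately show ?thesis by (rule filterlim_at_top_mono[rotated])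
qed

end


section \<open>Adjoint operators on the space of bounded sequences\<close>

lemma exists_nonzero_l1: "\<exists>x :: l1. x \<noteq> 0"
  using norm_l1_unit[of 0] by (metis norm_zero zero_neq_one)

section \<open>Eigenfunctionals on J-sets and perturbation of kernels\<close>

text \<open>An eigenfunctional turns \<open>T^k\<close> into multiplication by
  \<open>\<mu>^k\<close>, whose modulus tends to 1 or to 0 along any subsequence.\<close>

lemma J_set_imp_norm_functional_const:
  fixes h :: "'a::cbanach dual"
  assumes h: "h o\<^sub>B T = \<mu> *\<^sub>C h" and \<mu>: "cmod \<mu> \<le> 1" and y: "y \<in> J_set T x"
  shows "cmod (clop_apply h y) = (if cmod \<mu> = 1 then cmod (clop_apply h x) else 0)"
proof -
  have hT: "clop_apply h (clop_apply T z) = \<mu> * clop_apply h z" for z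
    using arg_cong[OF h, of "\<lambda>g. clop_apply g z"] by (simp add: clop_apply_scaleC)
  have hTn: "clop_apply h (clop_apply (T ^\<^sub>B n) z) = \<mu> ^ n * clop_apply h z" for n z
    by (induction n) (simp_all add: hT)
  obtain k X where k: "strict_mono k" and X: "X \<longlonglongrightarrow> x" "(\<lambda>n. clop_apply (T ^\<^sub>B k n) (X n)) \<longlonglongrightarrow> y"
    using y by (auto simp: J_set_def)
  have "(\<lambda>n. cmod \<mu> ^ k n) \<longlonglongrightarrow> (if cmod \<mu> = 1 then 1 else 0)"
    using LIMSEQ_subseq_LIMSEQ[OF LIMSEQ_power_zero k, of "cmod \<mu>"] \<mu> by (simp add: o_def)
  then have "(\<lambda>n. cmod \<mu> ^ k n * cmod (clop_apply h (X n))) \<longlonglongrightarrow>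
      (if cmod \<mu> = 1 then 1 else 0) * cmod (clop_apply h x)"
    by (intro tendsto_mult tendsto_norm bounded_linear.tendsto[OF bounded_linear_clop_apply] X)
  moreover have "(\<lambda>n. cmod (clop_apply h (clop_apply (T ^\<^sub>B k n) (X n)))) \<longlonglongrightarrow> cmod (clop_apply h y)"
    by (intro tendsto_norm bounded_linear.tendsto[OF bounded_linear_clop_apply] X)
  then have "(\<lambda>n. cmod \<mu> ^ k n * cmod (clop_apply h (X n))) \<longlonglongrightarrow> cmod (clop_apply h y)"
    by (simp add: hTn norm_mult norm_power)
  ultimately have "cmod (clop_apply h y) = (if cmod \<mu> = 1 then 1 else 0) * cmod (clop_apply h x)"
    by (rule LIMSEQ_unique[rotated])
  then show ?thesis by simp
qed

text \<open>If \<open>a\<close>, \<open>a + b\<close> and \<open>a - b\<close> have equal modulus,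
  the parallelogram law forces \<open>b = 0\<close>. Here \<open>a\<close> is the value at an
  interior point and \<open>b\<close> that of a small multiple of \<open>w\<close>.\<close>

lemma constant_modulus_functional_eq_0:
  fixes h :: "'a::cbanach dual"
  assumes "interior A \<noteq> {}" and const: "\<And>y. y \<in> A \<Longrightarrow> cmod (clop_apply h y) = C"
  shows "h = 0"
proof (rule clop_eqI)
  fix w :: 'a
  obtain y e where e: "0 < e" "ball y e \<subseteq> A"
    using assms(1) by (auto simp: mem_interior)
  define t where "t = e / 2 / (norm w + 1)"
  have nw: "0 < norm w + 1" by (simp add: add_nonneg_pos)
  have t: "0 < t" using e nw by (simp add: t_def)
  have tw: "t * norm w < e"
  proof -
    have "t * norm w \<le> t * (norm w + 1)" using t by simp
    also have "\<dots> = e / 2" using nw by (metis t_def nonzero_divide_eq_eq less_irrefl)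
    finally show ?thesis using e by simp
  qed
  define a where "a = clop_apply h y"
  define b where "b = complex_of_real t * clop_apply h w"
  have "cmod (a + c * b) = C" if "cmod c = 1 \<or> c = 0" for c
  proof -
    have "norm ((c * complex_of_real t) *\<^sub>C w) < e"
      using that tw t e by (auto simp: norm_mult)
    then have "y + (c * complex_of_real t) *\<^sub>C w \<in> A"
      using e by (intro subsetD[OF e(2)]) (simp add: dist_norm)
    from const[OF this] show ?thesis
      by (simp add: a_def b_def clop_add_right clop_scaleC mult.assoc)
  qed
  from this[of 0] this[of 1] this[of "-1"]
  have "cmod a = C" "cmod (a + b) = C" "cmod (a - b) = C" by auto
  moreover have "(cmod (a + b))\<^sup>2 + (cmod (a - b))\<^sup>2 = 2 * (cmod a)\<^sup>2 + 2 * (cmod b)\<^sup>2"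
    unfolding cmod_power2 by (simp add: power2_eq_square algebra_simps)
  ultimately have "(cmod b)\<^sup>2 = 0" by simp
  then show "clop_apply h w = clop_apply 0 w" using t by (simp add: b_def)
qed

text \<open>The almost-kernel vector \<open>v\<close> is corrected by a preimage \<open>g\<close> of
  \<open>A v\<close> that is shorter than \<open>v\<close>, so \<open>v - g\<close> is a non-zero
  kernel vector.\<close>

lemma kernel_perturbation:
  fixes A :: "'a::real_normed_vector \<Rightarrow> 'a"
  assumes onto: "\<And>f. \<exists>g. A g = f \<and> c * norm g \<le> norm f" and c: "0 < c"
    and lin: "linear A" and v: "v \<noteq> 0" "norm (A v) < c * norm v"
  obtains u where "u \<noteq> 0" "A u = 0"
proof -
  obtain g where g: "A g = A v" "c * norm g \<le> norm (A v)" using onto by blast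
  have "norm g < norm v" using g v c by (metis less_le_trans not_less order_less_le_trans mult_less_cancel_left_pos)
  then have "v - g \<noteq> 0" by auto
  moreover have "A (v - g) = 0" using g by (simp add: linear_diff[OF lin])
  ultimately show thesis using that by blast
qed

section \<open>Spectra of an adjoint operator and of its own adjoint\<close>

context
  fixes T :: "linf \<Rightarrow>\<^sub>B linf" and S :: "l1 \<Rightarrow>\<^sub>B l1"
  assumes TS: "is_adjoint_of T S"
begin

lemma pair_adjoint: "pair x (clop_apply T f) = pair (clop_apply S x) f"
  using TS by (simp add: is_adjoint_of_def)

lemma pair_adjoint_power: "pair x (clop_apply (T ^\<^sub>B n) f) = pair (clop_apply (S ^\<^sub>B n) x) f"
proof (induction n arbitrary: x)
  case (Suc n)
  have "clop_apply (S ^\<^sub>B n) (clop_apply S x) = clop_apply (S ^\<^sub>B (n + 1)) x"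
    unfolding clop_power_add by simp
  then show ?case by (simp add: pair_adjoint Suc)
qed simp

text \<open>The pairing is bilinear, so no conjugate of \<open>\<mu>\<close> appears.\<close>

lemma pair_adjoint_minus: "pair x (clop_apply T f - \<mu> *\<^sub>C f) = pair (clop_apply S x - \<mu> *\<^sub>C x) f"
  by (simp add: linear_diff[OF linear_pair_right] pair_scaleC_right pair_adjoint
      linear_diff[OF linear_pair_left] clop_scaleC)

lemma adjoint_power_onto:
  assumes "0 < \<kappa> (S ^\<^sub>B n)"
  obtains g where "clop_apply (T ^\<^sub>B n) g = f" "\<kappa> (S ^\<^sub>B n) * norm g \<le> norm f"
  by (rule bounded_below_imp_adjoint_onto[OF bounded_linear.linear[OF bounded_linear_clop_apply]
        clop_scaleC pair_adjoint_power assms kappa_le])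

lemma adjoint_minus_onto:
  assumes "0 < c" "\<And>x. c * norm x \<le> norm (clop_apply S x - \<mu> *\<^sub>C x)"
  shows "\<exists>g. clop_apply T g - \<mu> *\<^sub>C g = f \<and> c * norm g \<le> norm f"
proof -
  obtain g where "clop_apply T g - \<mu> *\<^sub>C g = f" "c * norm g \<le> norm f"
    by (rule bounded_below_imp_adjoint_onto[OF linear_clop_minus_scaleC _ pair_adjoint_minus assms])
      (simp_all add: clop_scaleC scaleC_diff_right mult.commute)
  then show ?thesis by blast
qed

text \<open>Eigenfunctionals for \<open>\<mu>\<close> are the non-zero functionals that annihilate
  the range of \<open>T - \<mu>\<close>. A lower bound for \<open>S - \<mu>\<close> makes that range
  everything; the failure of all lower bounds produces such a functional.\<close>

lemma point_spectrum_adjoint_iff: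
  "\<mu> \<in> \<sigma>\<^sub>p (banach_adjoint T) \<longleftrightarrow> \<not> (\<exists>c>0. \<forall>x. c * norm x \<le> norm (clop_apply S x - \<mu> *\<^sub>C x))"
proof
  assume "\<mu> \<in> \<sigma>\<^sub>p (banach_adjoint T)"
  then obtain h :: "linf dual" where h: "h \<noteq> 0" "h o\<^sub>B T = \<mu> *\<^sub>C h" by (auto simp: point_spectrum_def)
  have "clop_apply h (clop_apply T g - \<mu> *\<^sub>C g) = 0" for g
    using arg_cong[OF h(2), of "\<lambda>k. clop_apply k g"] by (simp add: clop_diff_right clop_scaleC clop_apply_scaleC)
  moreover obtain f where "clop_apply h f \<noteq> 0"
    using h(1) clop_eqI[of h 0] by auto
  ultimately show "\<not> (\<exists>c>0. \<forall>x. c * norm x \<le> norm (clop_apply S x - \<mu> *\<^sub>C x))"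
    using adjoint_minus_onto[of _ \<mu> f] by fastforce
next
  assume "\<not> (\<exists>c>0. \<forall>x. c * norm x \<le> norm (clop_apply S x - \<mu> *\<^sub>C x))"
  then have "\<exists>x. norm (clop_apply S x - \<mu> *\<^sub>C x) < c * norm x" if "0 < c" for c
    using that by (metis not_le)
  then obtain h :: "linf dual" where h: "h \<noteq> 0" "\<And>g. clop_apply h (clop_apply T g - \<mu> *\<^sub>C g) = 0"
    using not_bounded_below_imp_adjoint_range_annihilated[OF linear_clop_minus_scaleC pair_adjoint_minus]
    by metis
  then have "h o\<^sub>B T = \<mu> *\<^sub>C h"
    by (intro clop_eqI) (simp add: clop_diff_right clop_scaleC clop_apply_scaleC)
  then show "\<mu> \<in> \<sigma>\<^sub>p (banach_adjoint T)" using h(1) by (auto simp: point_spectrum_def)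
qed

text \<open>A lower bound \<open>d\<close> at a point persists with constant \<open>d / 2\<close> on
  the ball of radius \<open>d / 2\<close>; finitely many such balls cover the disc.\<close>

lemma uniformly_bounded_below_on_disc:
  assumes "\<sigma>\<^sub>p (banach_adjoint T) \<inter> cball 0 1 = {}"
  obtains c where "0 < c" "\<And>\<mu> x. cmod \<mu> \<le> 1 \<Longrightarrow> c * norm x \<le> norm (clop_apply S x - \<mu> *\<^sub>C x)"
proof -
  have "\<exists>c>0. \<forall>x. c * norm x \<le> norm (clop_apply S x - \<mu> *\<^sub>C x)" if "\<mu> \<in> cball 0 1" for \<mu>
    using assms that point_spectrum_adjoint_iff by blast
  then obtain d where d: "\<And>\<mu>. \<mu> \<in> cball 0 1 \<Longrightarrow> 0 < d \<mu>"
      "\<And>\<mu> x. \<mu> \<in> cball 0 1 \<Longrightarrow> d \<mu> * norm x \<le> norm (clop_apply S x - \<mu> *\<^sub>C x)"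
    by metis
  obtain M where M: "M \<subseteq> cball 0 1" "finite M" "cball (0::complex) 1 \<subseteq> (\<Union>\<mu>\<in>M. ball \<mu> (d \<mu> / 2))"
  proof (rule compactE_image[OF compact_cball, of "cball 0 1" "\<lambda>\<mu>. ball \<mu> (d \<mu> / 2)"])
    show "cball (0::complex) 1 \<subseteq> (\<Union>\<mu>\<in>cball 0 1. ball \<mu> (d \<mu> / 2))"
      using d(1) by (fastforce intro: centre_in_ball[THEN iffD2])
  qed auto
  have "M \<noteq> {}" using M(3) by auto
  define c where "c = Min ((\<lambda>\<mu>. d \<mu> / 2) ` M)"
  have c_le: "c \<le> d \<nu> / 2" if "\<nu> \<in> M" for \<nu> unfolding c_def by (rule Min_le) (use that M in auto)
  show thesis
  proof (rule that)
    show "0 < c" unfolding c_def using M \<open>M \<noteq> {}\<close> d(1) by (subst Min_gr_iff) auto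
    fix \<mu> x assume "cmod \<mu> \<le> 1"
    then obtain \<nu> where \<nu>: "\<nu> \<in> M" "dist \<nu> \<mu> < d \<nu> / 2" using M(3) by (auto simp: subset_iff)
    have "d \<nu> * norm x \<le> norm (clop_apply S x - \<nu> *\<^sub>C x)" using d(2) M(1) \<nu>(1) by blast
    also have "clop_apply S x - \<nu> *\<^sub>C x = (clop_apply S x - \<mu> *\<^sub>C x) - (\<nu> - \<mu>) *\<^sub>C x"
      by (simp add: scaleC_diff_left)
    also have "norm \<dots> \<le> norm (clop_apply S x - \<mu> *\<^sub>C x) + norm ((\<nu> - \<mu>) *\<^sub>C x)"
      by (rule norm_triangle_ineq4)
    also have "norm ((\<nu> - \<mu>) *\<^sub>C x) \<le> (d \<nu> / 2) * norm x"
      unfolding norm_scaleC dist_norm[symmetric] by (rule mult_right_mono) (use \<nu>(2) in auto)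
    finally have "(d \<nu> / 2) * norm x \<le> norm (clop_apply S x - \<mu> *\<^sub>C x)" by (simp add: algebra_simps)
    moreover have "c * norm x \<le> (d \<nu> / 2) * norm x" by (rule mult_right_mono[OF c_le[OF \<nu>(1)]]) simp
    ultimately show "c * norm x \<le> norm (clop_apply S x - \<mu> *\<^sub>C x)" by linarith
  qed
qed

lemma disc_disjoint_imp_i_index_gt_1:
  assumes "\<sigma>\<^sub>p (banach_adjoint T) \<inter> cball 0 1 = {}"
  shows "1 < i_index S"
proof -
  obtain c where c: "0 < c" "\<And>\<mu> x. cmod \<mu> \<le> 1 \<Longrightarrow> c * norm x \<le> norm (clop_apply S x - \<mu> *\<^sub>C x)"
    using uniformly_bounded_below_on_disc[OF assms] by blast
  obtain N where "0 < N" "\<And>x. 2 * norm x \<le> norm (clop_apply (S ^\<^sub>B N) x)"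
    using bounded_below_on_disc_imp_expanding_power[OF c] by blast
  moreover obtain x0 :: l1 where "x0 \<noteq> 0" using exists_nonzero_l1 by blast
  ultimately show ?thesis using i_index_gt_1I[of x0 N 2 S] by simp
qed

text \<open>If \<open>\<kappa> (S ^\<^sub>B n) > 2\<close>, then \<open>S^n - \<mu>^n\<close> is
  bounded below by 1 for all \<open>\<mu>\<close> in the closed disc. It factors as the quotient,
  bounded by \<open>K\<close>, after \<open>S - \<mu>\<close>, which is therefore bounded below by
  \<open>1 / K\<close>.\<close>

lemma i_index_gt_1_imp_disc_disjoint:
  assumes "1 < i_index S"
  shows "\<sigma>\<^sub>p (banach_adjoint T) \<inter> cball 0 1 = {}"
proof -
  obtain x0 :: l1 where x0: "x0 \<noteq> 0" using exists_nonzero_l1 by blast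
  have "\<forall>\<^sub>F n in sequentially. 2 < \<kappa> (S ^\<^sub>B n)"
    using i_index_gt_1_imp_kappa_power_at_top[OF x0 assms] by (auto simp: filterlim_at_top_dense)
  then obtain n where n: "2 < \<kappa> (S ^\<^sub>B n)" by (auto simp: eventually_sequentially)
  have "\<mu> \<notin> \<sigma>\<^sub>p (banach_adjoint T)" if \<mu>: "cmod \<mu> \<le> 1" for \<mu>
  proof -
    define K where "K = (\<Sum>k<n. norm (S ^\<^sub>B (n - Suc k))) + 1"
    have K: "0 < K" by (simp add: K_def add_nonneg_pos sum_nonneg)
    have quot: "norm (power_quotient S n \<mu> y) \<le> K * norm y" for y
    proof -
      have "norm (power_quotient S n \<mu> y) \<le> (\<Sum>k<n. norm (S ^\<^sub>B (n - Suc k)) * norm y)"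
        unfolding power_quotient_def
      proof (rule sum_norm_le)
        fix k
        have "cmod \<mu> ^ k * norm (clop_apply (S ^\<^sub>B (n - Suc k)) y) \<le> 1 * (norm (S ^\<^sub>B (n - Suc k)) * norm y)"
          by (rule mult_mono) (auto simp: norm_clop_le power_le_one \<mu>)
        then show "norm (\<mu> ^ k *\<^sub>C clop_apply (S ^\<^sub>B (n - Suc k)) y) \<le> norm (S ^\<^sub>B (n - Suc k)) * norm y"
          by (simp add: norm_power)
      qed
      also have "\<dots> \<le> K * norm y" by (simp add: K_def sum_distrib_right distrib_right)
      finally show ?thesis .
    qed
    have "inverse K * norm x \<le> norm (clop_apply S x - \<mu> *\<^sub>C x)" for x
    proof -
      have "norm (\<mu> ^ n *\<^sub>C x) \<le> norm x"
        using \<mu> by (simp add: norm_power mult_left_le_one_le power_le_one)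
      moreover have "2 * norm x \<le> norm (clop_apply (S ^\<^sub>B n) x)"
        using kappa_le[of "S ^\<^sub>B n" x] mult_right_mono[OF less_imp_le[OF n], of "norm x"] by simp
      ultimately have "norm x \<le> norm (clop_apply (S ^\<^sub>B n) x - \<mu> ^ n *\<^sub>C x)"
        using norm_triangle_ineq2[of "clop_apply (S ^\<^sub>B n) x" "\<mu> ^ n *\<^sub>C x"] by linarith
      also have "\<dots> = norm (clop_apply S (power_quotient S n \<mu> x) - \<mu> *\<^sub>C power_quotient S n \<mu> x)"
        by (simp only: power_quotient)
      also have "\<dots> = norm (power_quotient S n \<mu> (clop_apply S x - \<mu> *\<^sub>C x))"
        using power_quotient_commute[of S 1 n \<mu> x] by (simp add: power_quotient_diff)
      also have "\<dots> \<le> K * norm (clop_apply S x - \<mu> *\<^sub>C x)" by (rule quot)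
      finally show ?thesis using K by (simp add: field_simps)
    qed
    then show ?thesis unfolding point_spectrum_adjoint_iff using K by (metis inverse_positive_iff_positive)
  qed
  then show ?thesis by auto
qed

text \<open>An eigenvector for \<open>a\<close> is almost in the kernel of \<open>T - b\<close> when
  \<open>b\<close> is closer than \<open>c\<close>, and \<open>T - b\<close> is onto with constant
  \<open>c\<close>, so \<open>kernel_perturbation\<close> applies. Because \<open>c\<close> is the
  same on the whole disc, finitely many steps along the segment from \<open>\<mu>\<close> to
  \<open>\<nu>\<close> suffice.\<close>

lemma point_spectrum_spreads_over_disc:
  assumes disj: "\<sigma>\<^sub>p (banach_adjoint T) \<inter> cball 0 1 = {}"
    and \<mu>: "\<mu> \<in> \<sigma>\<^sub>p T" "\<mu> \<in> cball 0 1" and \<nu>: "\<nu> \<in> cball 0 1"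
  shows "\<nu> \<in> \<sigma>\<^sub>p T"
proof -
  obtain c where c: "0 < c" "\<And>\<mu> x. cmod \<mu> \<le> 1 \<Longrightarrow> c * norm x \<le> norm (clop_apply S x - \<mu> *\<^sub>C x)"
    using uniformly_bounded_below_on_disc[OF disj] by blast
  have step: "b \<in> \<sigma>\<^sub>p T" if a: "a \<in> \<sigma>\<^sub>p T" and b: "b \<in> cball 0 1" "dist a b < c" for a b
  proof -
    obtain v where v: "v \<noteq> 0" "clop_apply T v = a *\<^sub>C v" using a by (auto simp: point_spectrum_def)
    have "clop_apply T v - b *\<^sub>C v = (a - b) *\<^sub>C v" by (simp add: v(2) scaleC_diff_left)
    then have "norm (clop_apply T v - b *\<^sub>C v) < c * norm v" using v(1) b(2) by (simp add: dist_norm)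
    moreover have "\<exists>g. clop_apply T g - b *\<^sub>C g = f \<and> c * norm g \<le> norm f" for f
      by (rule adjoint_minus_onto[OF c(1) c(2)]) (use b(1) in simp)
    ultimately obtain u where "u \<noteq> 0" "clop_apply T u - b *\<^sub>C u = 0"
      using kernel_perturbation[OF _ c(1) linear_clop_minus_scaleC v(1)] by metis
    then show ?thesis by (auto simp: point_spectrum_def)
  qed
  obtain n where n: "dist \<mu> \<nu> / c < real n" using reals_Archimedean2 by blast
  have n0: "0 < real n" using n c(1) by (smt (verit) divide_nonneg_pos zero_le_dist)
  define p where "p k = \<mu> + complex_of_real (real k / real n) * (\<nu> - \<mu>)" for k
  have "p k \<in> \<sigma>\<^sub>p T" if "k \<le> n" for k
    using that
  proof (induction k)
    case 0
    show ?case using \<mu>(1) by (simp add: p_def)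
  next
    case (Suc k)
    show ?case
    proof (rule step)
      show "p k \<in> \<sigma>\<^sub>p T" using Suc by simp
      have "p (Suc k) = (1 - real (Suc k) / real n) *\<^sub>R \<mu> + (real (Suc k) / real n) *\<^sub>R \<nu>"
      proof -
        have "\<mu> + complex_of_real t * (\<nu> - \<mu>) = (1 - t) *\<^sub>R \<mu> + t *\<^sub>R \<nu>" for t
          by (simp add: scaleR_conv_of_real algebra_simps)
        then show ?thesis unfolding p_def .
      qed
      also have "\<dots> \<in> cball 0 1"
        by (rule convexD[OF convex_cball \<mu>(2) \<nu>]) (use Suc.prems n0 in auto)
      finally show "p (Suc k) \<in> cball 0 1" .
      have "p (Suc k) - p k = complex_of_real (1 / real n) * (\<nu> - \<mu>)"
      proof -
        have "complex_of_real (real (Suc k) / real n) = complex_of_real (real k / real n) + complex_of_real (1 / real n)"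
          by (simp add: add_divide_distrib)
        then show ?thesis by (simp only: p_def) (simp add: distrib_right)
      qed
      then have "dist (p k) (p (Suc k)) = dist \<mu> \<nu> / real n"
        by (simp add: dist_norm norm_minus_commute[of "p k"] norm_minus_commute[of \<mu>] norm_mult norm_divide)
      also have "\<dots> < c" using n n0 c(1) by (simp add: field_simps)
      finally show "dist (p k) (p (Suc k)) < c" .
    qed
  qed
  from this[of n] show ?thesis using n0 by (simp add: p_def)
qed

section \<open>J-sets of an adjoint operator\<close>

text \<open>Preimages \<open>z n\<close> of \<open>y\<close> under \<open>T^n\<close> tend to zero
  because the minimum moduli blow up. Adding them to a kernel vector \<open>x\<close> leaves
  \<open>T^n (x + z n) = y\<close> for \<open>n > 0\<close>.\<close>

lemma kernel_nonzero_imp_Jmix_class: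
  assumes i: "1 < i_index S" and 0: "0 \<in> \<sigma>\<^sub>p T"
  shows "Jmix_class T"
proof -
  obtain x0 :: l1 where x0: "x0 \<noteq> 0" using exists_nonzero_l1 by blast
  note top = i_index_gt_1_imp_kappa_power_at_top[OF x0 i]
  obtain x where x: "x \<noteq> 0" "clop_apply T x = 0" using 0 by (auto simp: point_spectrum_def)
  have Tx: "clop_apply (T ^\<^sub>B n) x = 0" if "0 < n" for n
    using clop_power_add[of T "n - 1" 1 x] that x(2) by simp
  have "y \<in> Jmix_set T x" for y
  proof -
    \<comment> \<open>Positivity is needed only eventually; stated as an implication, the choice can
      be made for all \<open>n\<close> at once.\<close>
    have "\<exists>g. 0 < \<kappa> (S ^\<^sub>B n) \<longrightarrow> clop_apply (T ^\<^sub>B n) g = y \<and> \<kappa> (S ^\<^sub>B n) * norm g \<le> norm y" for n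
      using adjoint_power_onto by metis
    then obtain z where z: "\<And>n. 0 < \<kappa> (S ^\<^sub>B n) \<Longrightarrow> clop_apply (T ^\<^sub>B n) (z n) = y"
        "\<And>n. 0 < \<kappa> (S ^\<^sub>B n) \<Longrightarrow> \<kappa> (S ^\<^sub>B n) * norm (z n) \<le> norm y" by metis
    have pos: "\<forall>\<^sub>F n in sequentially. 0 < \<kappa> (S ^\<^sub>B n)"
      using top by (auto simp: filterlim_at_top_dense)
    have "(\<lambda>n. norm y / \<kappa> (S ^\<^sub>B n)) \<longlonglongrightarrow> 0"
      by (rule tendsto_divide_0[OF tendsto_const filterlim_at_top_imp_at_infinity[OF top]])
    moreover have "\<forall>\<^sub>F n in sequentially. norm (z n) \<le> norm y / \<kappa> (S ^\<^sub>B n)"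
      using pos by eventually_elim (use z(2) in \<open>simp add: pos_le_divide_eq mult.commute\<close>)
    ultimately have "z \<longlonglongrightarrow> 0" by (rule Lim_null_comparison[rotated])
    then have "(\<lambda>n. x + z n) \<longlonglongrightarrow> x" using tendsto_add[OF tendsto_const[of x]] by force
    moreover have "(\<lambda>n. clop_apply (T ^\<^sub>B n) (x + z n)) \<longlonglongrightarrow> y"
    proof (rule tendsto_eventually)
      show "\<forall>\<^sub>F n in sequentially. clop_apply (T ^\<^sub>B n) (x + z n) = y"
        using pos eventually_gt_at_top[of 0] by eventually_elim (simp add: clop_add_right Tx z(1))
    qed
    ultimately show ?thesis by (auto simp: Jmix_set_def)
  qed
  then show ?thesis using x(1) by (auto simp: Jmix_class_def)
qed

text \<open>Injectivity makes the short preimage the only one, so \<open>T^n\<close> expands by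
  \<open>\<kappa> (S ^\<^sub>B n)\<close>. A sequence with convergent images under
  \<open>T^(k n)\<close> must then tend to zero.\<close>

lemma injective_and_J_set_nonempty_imp_eq_0:
  assumes i: "1 < i_index S" and 0: "0 \<notin> \<sigma>\<^sub>p T" and y: "y \<in> J_set T x"
  shows "x = 0"
proof -
  obtain x0 :: l1 where x0: "x0 \<noteq> 0" using exists_nonzero_l1 by blast
  note top = i_index_gt_1_imp_kappa_power_at_top[OF x0 i]
  have inj: "u = 0" if "clop_apply T u = 0" for u
    using 0 that by (auto simp: point_spectrum_def)
  have inj_power: "u = 0" if "clop_apply (T ^\<^sub>B n) u = 0" for n u
    using that by (induction n) (auto dest: inj)
  have expand: "\<kappa> (S ^\<^sub>B n) * norm u \<le> norm (clop_apply (T ^\<^sub>B n) u)" if pos: "0 < \<kappa> (S ^\<^sub>B n)" for n u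
  proof -
    obtain g where g: "clop_apply (T ^\<^sub>B n) g = clop_apply (T ^\<^sub>B n) u"
        "\<kappa> (S ^\<^sub>B n) * norm g \<le> norm (clop_apply (T ^\<^sub>B n) u)"
      using adjoint_power_onto[OF pos] by metis
    have "u - g = 0" by (rule inj_power[of n]) (simp add: clop_diff_right g(1))
    then show ?thesis using g(2) by simp
  qed
  obtain k X where k: "strict_mono k" and X: "X \<longlonglongrightarrow> x" "(\<lambda>n. clop_apply (T ^\<^sub>B k n) (X n)) \<longlonglongrightarrow> y"
    using y by (auto simp: J_set_def)
  have topk: "filterlim (\<lambda>n. \<kappa> (S ^\<^sub>B k n)) at_top sequentially"
    by (rule filterlim_compose[OF top filterlim_subseq[OF k]])
  then have pos: "\<forall>\<^sub>F n in sequentially. 0 < \<kappa> (S ^\<^sub>B k n)"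
    by (auto simp: filterlim_at_top_dense)
  have "(\<lambda>n. norm (clop_apply (T ^\<^sub>B k n) (X n)) / \<kappa> (S ^\<^sub>B k n)) \<longlonglongrightarrow> 0"
    by (rule tendsto_divide_0[OF tendsto_norm[OF X(2)] filterlim_at_top_imp_at_infinity[OF topk]])
  moreover have "\<forall>\<^sub>F n in sequentially. norm (X n) \<le> norm (clop_apply (T ^\<^sub>B k n) (X n)) / \<kappa> (S ^\<^sub>B k n)"
    using pos by eventually_elim (use expand in \<open>simp add: pos_le_divide_eq mult.commute\<close>)
  ultimately have "X \<longlonglongrightarrow> 0" by (rule Lim_null_comparison[rotated])
  then show ?thesis using X(1) LIMSEQ_unique by blast
qed

lemma J_set_interior_imp:
  assumes x: "x \<noteq> 0" and int: "interior (J_set T x) \<noteq> {}"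
  shows "1 < i_index S" "0 \<in> \<sigma>\<^sub>p T"
proof -
  have "\<mu> \<notin> \<sigma>\<^sub>p (banach_adjoint T)" if \<mu>: "cmod \<mu> \<le> 1" for \<mu>
  proof
    assume "\<mu> \<in> \<sigma>\<^sub>p (banach_adjoint T)"
    then obtain h :: "linf dual" where h: "h \<noteq> 0" "h o\<^sub>B T = \<mu> *\<^sub>C h" by (auto simp: point_spectrum_def)
    note J_set_imp_norm_functional_const[OF h(2) \<mu>, of _ x]
    from constant_modulus_functional_eq_0[OF int this] have "h = 0" .
    with h(1) show False by blast
  qed
  then have "\<sigma>\<^sub>p (banach_adjoint T) \<inter> cball 0 1 = {}" by auto
  then show i: "1 < i_index S" by (rule disc_disjoint_imp_i_index_gt_1)
  show "0 \<in> \<sigma>\<^sub>p T"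
  proof (rule ccontr)
    assume "0 \<notin> \<sigma>\<^sub>p T"
    moreover obtain y where "y \<in> interior (J_set T x)" using int by blast
    then have "y \<in> J_set T x" by (rule subsetD[OF interior_subset])
    ultimately have "x = 0" by (rule injective_and_J_set_nonempty_imp_eq_0[OF i])
    with x show False by blast
  qed
qed

section \<open>Spectrum on the unit circle\<close>

text \<open>The lower bound for \<open>S - \<mu>\<close> makes \<open>T - \<mu>\<close> onto with
  controlled preimages; if it were also injective, choosing preimages would define a bounded inverse
  \<open>G\<close>.\<close>

lemma spectrum_imp_point_spectrum:
  assumes c: "0 < c" "\<And>x. c * norm x \<le> norm (clop_apply S x - \<mu> *\<^sub>C x)" and \<mu>: "\<mu> \<in> \<sigma> T"
  shows "\<mu> \<in> \<sigma>\<^sub>p T"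
proof (rule ccontr)
  assume "\<mu> \<notin> \<sigma>\<^sub>p T"
  then have inj: "u = 0" if "clop_apply T u - \<mu> *\<^sub>C u = 0" for u
    using that by (auto simp: point_spectrum_def)
  let ?A = "\<lambda>u. clop_apply T u - \<mu> *\<^sub>C u"
  have lin: "linear ?A" by (rule linear_clop_minus_scaleC)
  have A: "clop_apply (T - \<mu> *\<^sub>C clop_id) u = ?A u" for u
    by (simp add: clop_apply_diff clop_apply_scaleC)
  have "\<forall>f. \<exists>g. ?A g = f \<and> c * norm g \<le> norm f"
    using adjoint_minus_onto[OF c] by (rule allI)
  then obtain G where "\<forall>f. ?A (G f) = f \<and> c * norm (G f) \<le> norm f"
    by (rule choice[THEN exE])
  then have G: "\<And>f. ?A (G f) = f" "\<And>f. c * norm (G f) \<le> norm f" by simp_all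
  \<comment> \<open>Uniqueness of preimages; additivity and homogeneity of the chosen
    \<open>G\<close> all follow from it.\<close>
  have GI: "G f = g" if "?A g = f" for f g
  proof -
    have "?A (G f - g) = ?A (G f) - ?A g" by (rule linear_diff[OF lin])
    also have "\<dots> = f - f" unfolding G(1) that ..
    also have "\<dots> = 0" by simp
    finally have "G f - g = 0" by (rule inj)
    then show ?thesis by simp
  qed
  have "bounded_linear G"
  proof (rule bounded_linear_intro[where K = "inverse c"])
    show "G (f + g) = G f + G g" for f g
      by (rule GI) (simp only: linear_add[OF lin] G(1))
    show "G (r *\<^sub>R f) = r *\<^sub>R G f" for r f
      by (rule GI) (simp only: linear_scale[OF lin] G(1))
    show "norm (G f) \<le> norm f * inverse c" for f
      using G(2)[of f] c(1) by (simp add: field_simps)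
  qed
  moreover have "G (a *\<^sub>C f) = a *\<^sub>C G f" for a f
  proof (rule GI)
    have "?A (a *\<^sub>C G f) = a *\<^sub>C ?A (G f)"
      by (simp add: clop_scaleC scaleC_diff_right mult.commute)
    then show "?A (a *\<^sub>C G f) = a *\<^sub>C f" by (simp only: G(1))
  qed
  ultimately obtain R where R: "clop_apply R = G" using clop_exists by blast
  have "R o\<^sub>B (T - \<mu> *\<^sub>C clop_id) = clop_id"
    by (rule clop_eqI) (simp add: R A GI)
  moreover have "(T - \<mu> *\<^sub>C clop_id) o\<^sub>B R = clop_id"
    by (rule clop_eqI) (simp add: R A G(1))
  ultimately show False using \<mu> by (auto simp: spectrum_def)
qed

lemma circle_spectrum_imp_disc_subset:
  assumes "\<sigma> T \<inter> sphere 0 1 \<noteq> {}" and disj: "\<sigma>\<^sub>p (banach_adjoint T) \<inter> cball 0 1 = {}"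
  shows "cball 0 1 \<subseteq> \<sigma>\<^sub>p T"
proof
  fix \<nu> :: complex assume \<nu>: "\<nu> \<in> cball 0 1"
  obtain \<mu> where \<mu>: "\<mu> \<in> \<sigma> T" "cmod \<mu> = 1" using assms(1) by auto
  obtain c where c: "0 < c" "\<And>\<mu> x. cmod \<mu> \<le> 1 \<Longrightarrow> c * norm x \<le> norm (clop_apply S x - \<mu> *\<^sub>C x)"
    using uniformly_bounded_below_on_disc[OF disj] by blast
  have "\<mu> \<in> \<sigma>\<^sub>p T" by (rule spectrum_imp_point_spectrum[OF c(1) c(2) \<mu>(1)]) (simp add: \<mu>(2))
  then show "\<nu> \<in> \<sigma>\<^sub>p T"
    by (rule point_spectrum_spreads_over_disc[OF disj _ _ \<nu>]) (simp add: \<mu>(2))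
qed

text \<open>The eigenvalue 0 spreads to the eigenvalue 1 on the circle, and a fixed vector of
  \<open>T\<close> excludes a left inverse of \<open>T - 1\<close>.\<close>

lemma kernel_nonzero_imp_circle_spectrum:
  assumes i: "1 < i_index S" and 0: "0 \<in> \<sigma>\<^sub>p T"
  shows "\<sigma> T \<inter> sphere 0 1 \<noteq> {}"
proof -
  have "1 \<in> \<sigma>\<^sub>p T"
    by (rule point_spectrum_spreads_over_disc[OF i_index_gt_1_imp_disc_disjoint[OF i] 0]) auto
  then obtain v where v: "v \<noteq> 0" "clop_apply T v = v" by (auto simp: point_spectrum_def)
  have "1 \<in> \<sigma> T"
    unfolding spectrum_def mem_Collect_eq
  proof
    assume "\<exists>R. R o\<^sub>B (T - 1 *\<^sub>C clop_id) = clop_id \<and> (T - 1 *\<^sub>C clop_id) o\<^sub>B R = clop_id"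
    then obtain R where "R o\<^sub>B (T - 1 *\<^sub>C clop_id) = clop_id" by blast
    from arg_cong[OF this, of "\<lambda>k. clop_apply k v"] show False
      using v by (simp add: clop_apply_diff)
  qed
  then show ?thesis by auto
qed

end

lemma Jmix_class_imp_J_class: "Jmix_class T \<Longrightarrow> J_class T"
proof -
  have "Jmix_set T x \<subseteq> J_set T x" for x
    by (auto simp: Jmix_set_def J_set_def intro!: exI[of _ "\<lambda>n. n"] strict_monoI)
  then show "Jmix_class T \<Longrightarrow> J_class T" unfolding Jmix_class_def J_class_def by blast
qed

theorem corollary3p6:
  fixes T :: "linf \<Rightarrow>\<^sub>B linf" and S :: "l1 \<Rightarrow>\<^sub>B l1"
  assumes "is_adjoint_of T S"
  shows "(Jmix_class T \<longleftrightarrow> J_class T) \<and>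
    (Jmix_class T \<longleftrightarrow> (\<exists>x. x \<noteq> 0 \<and> interior (J_set T x) \<noteq> {})) \<and>
    (Jmix_class T \<longleftrightarrow> \<sigma> T \<inter> sphere 0 1 \<noteq> {} \<and> \<sigma>\<^sub>p (banach_adjoint T) \<inter> cball 0 1 = {}) \<and>
    (Jmix_class T \<longleftrightarrow> i_index S > 1 \<and> cball 0 1 \<subseteq> \<sigma>\<^sub>p T) \<and>
    (Jmix_class T \<longleftrightarrow> i_index S > 1 \<and> 0 \<in> \<sigma>\<^sub>p T)"
proof -
  have 12: "Jmix_class T \<Longrightarrow> J_class T" by (rule Jmix_class_imp_J_class)
  have 23: "\<exists>x. x \<noteq> 0 \<and> interior (J_set T x) \<noteq> {}" if J: "J_class T"
  proof -
    obtain x where "x \<noteq> 0" "J_set T x = UNIV" using J by (auto simp: J_class_def)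
    then show ?thesis by (intro exI[of _ x]) simp
  qed
  have 36: "1 < i_index S \<and> 0 \<in> \<sigma>\<^sub>p T" if "\<exists>x. x \<noteq> 0 \<and> interior (J_set T x) \<noteq> {}"
    using that J_set_interior_imp[OF assms] by blast
  have 61: "Jmix_class T" if "1 < i_index S \<and> 0 \<in> \<sigma>\<^sub>p T"
    using that kernel_nonzero_imp_Jmix_class[OF assms] by blast
  have 64: "\<sigma> T \<inter> sphere 0 1 \<noteq> {} \<and> \<sigma>\<^sub>p (banach_adjoint T) \<inter> cball 0 1 = {}"
    if "1 < i_index S \<and> 0 \<in> \<sigma>\<^sub>p T"
    using that kernel_nonzero_imp_circle_spectrum[OF assms] i_index_gt_1_imp_disc_disjoint[OF assms] by blast
  have 45: "1 < i_index S \<and> cball 0 1 \<subseteq> \<sigma>\<^sub>p T"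
    if "\<sigma> T \<inter> sphere 0 1 \<noteq> {} \<and> \<sigma>\<^sub>p (banach_adjoint T) \<inter> cball 0 1 = {}"
    using that circle_spectrum_imp_disc_subset[OF assms] disc_disjoint_imp_i_index_gt_1[OF assms] by blast
  have 56: "1 < i_index S \<and> 0 \<in> \<sigma>\<^sub>p T" if "1 < i_index S \<and> cball 0 1 \<subseteq> \<sigma>\<^sub>p T"
    using that by auto
  \<comment> \<open>Two loops meeting in \<open>F\<close>: one through \<open>A\<close>,
    \<open>B\<close>, \<open>C\<close>, the other through \<open>D\<close>,
    \<open>E\<close>.\<close>
  have cycle: "(A \<longleftrightarrow> B) \<and> (A \<longleftrightarrow> C) \<and> (A \<longleftrightarrow> D) \<and> (A \<longleftrightarrow> E) \<and> (A \<longleftrightarrow> F)"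
    if "A \<Longrightarrow> B" "B \<Longrightarrow> C" "C \<Longrightarrow> F" "F \<Longrightarrow> A" "F \<Longrightarrow> D" "D \<Longrightarrow> E" "E \<Longrightarrow> F" for A B C D E F
    using that by blast
  show ?thesis by (rule cycle[OF 12 23 36 61 64 45 56])
qed

end
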